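(* If $K$ is a compact operator on a Hausdorff topological vector space $X$, then $r(K)\le|\sigma(K)|$.
   Context: Spaces are over $\mathbb{C}$. A linear operator $K$ on $X$ is compact if it maps some zero neighborhood into a precompact set, where a set is called precompact if its closure is compact. Every compact operator is nb-bounded (see below). Every base of zero neighborhoods that is mentioned is assumed to consist of balanced sets, to be closed under multiplication by nonzero scalars, and such that for members $V_1,V_2,V$ there are members $W\subseteq V_1\cap V_2$ and $U$ with $U+U\subseteq V$; in a locally convex space its members are also assumed convex. A linear operator $T$ is bb-bounded if it maps bounded sets to bounded sets; nn-bounded if there is a base $\mathcal{N}_0$ of zero neighborhoods such that for every $U\in\mathcal{N}_0$ there is $\alpha>0$ with $T(U)\subseteq\alpha U$; nb-bounded if it maps some zero neighborhood into a bounded set. Spectra: $\rho^{bb}(T)$ (resp. $\rho^{c}(T)$, $\rho^{nn}(T)$) is the set of $\lambda\in\mathbb{C}$ such that $\lambda I-T$ has a two-sided inverse that is bb-bounded (resp. continuous, nn-bounded); $\rho^{nb}(T)$ is the set of $\lambda\in\mathbb{C}$ such that $\lambda I-T$ has a two-sided inverse of the form $\alpha I+S$ with $\alpha$ a scalar and $S$ nb-bounded. $\sigma^{bb}(T),\sigma^{c}(T),\sigma^{nn}(T),\sigma^{nb}(T)$ are their complements in $\mathbb{C}$. Spectral radii: $r_{bb}(T)$, $r_c(T)$, $r_{nn}(T)$, $r_{nb}(T)$ are the infima of those $\nu>0$ for which $T^n/\nu^n\to0$, respectively: uniformly on every bounded set; equicontinuously (for every zero neighborhood $V$ there is a zero neighborhood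 $U$ such that for all $\varepsilon>0$, $\frac{T^n}{\nu^n}(U)\subseteq\varepsilon V$ for all large $n$); in the nn-sense (there is a base $\mathcal{N}_0$ of zero neighborhoods such that for every $U\in\mathcal{N}_0$, $\varepsilon>0$: $\frac{T^n}{\nu^n}(U)\subseteq\varepsilon U$ for all large $n$); uniformly on some zero neighborhood. Here $\inf\emptyset=\infty$. For an nb-bounded operator $T$ one has $\sigma^{bb}(T)=\sigma^c(T)=\sigma^{nn}(T)=\sigma^{nb}(T)$ and $r_{bb}(T)=r_c(T)=r_{nn}(T)=r_{nb}(T)$; the common values are denoted $\sigma(T)$ and $r(T)$. Also $|\sigma(T)|=\sup\{|\lambda| : \lambda\in\sigma(T)\}$, with $\sup\emptyset=0$. *)

theory Defs
  imports "HOL-Analysis.Analysis"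
begin

text \<open>Complex topological vector spaces. The Hausdorff property is not part of the locale; it
  is added, where needed, through the class \<^class>\<open>t2_space\<close>.\<close>

locale complex_tvs = vector_space scale
  for scale :: "complex \<Rightarrow> 'a::topological_ab_group_add \<Rightarrow> 'a" (infixr "*\<^sub>C" 75) +
  assumes continuous_scale: "continuous_on UNIV (\<lambda>p. fst p *\<^sub>C snd p)"
begin

text \<open>Zero neighborhoods need not be open.\<close>

definition zero_nbhd :: "'a set \<Rightarrow> bool" where
  "zero_nbhd U \<longleftrightarrow> 0 \<in> interior U"

definition balanced :: "'a set \<Rightarrow> bool" where
  "balanced U \<longleftrightarrow> (\<forall>c. cmod c \<le> 1 \<longrightarrow> (*\<^sub>C) c ` U \<subseteq> U)"

text \<open>The type \<^typ>\<open>'a\<close> is not in \<^class>\<open>real_vector\<close>, so \<^const>\<open>convex\<close> does not apply.\<close>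

definition cvx :: "'a set \<Rightarrow> bool" where
  "cvx U \<longleftrightarrow> (\<forall>x\<in>U. \<forall>y\<in>U. \<forall>u\<ge>0. \<forall>v\<ge>0. u + v = 1 \<longrightarrow>
     complex_of_real u *\<^sub>C x + complex_of_real v *\<^sub>C y \<in> U)"

definition locally_convex :: bool where
  "locally_convex \<longleftrightarrow> (\<forall>V. zero_nbhd V \<longrightarrow> (\<exists>U\<subseteq>V. zero_nbhd U \<and> cvx U))"

definition zero_base :: "'a set set \<Rightarrow> bool" where
  "zero_base N \<longleftrightarrow>
     (\<forall>U\<in>N. zero_nbhd U) \<and>
     (\<forall>V. zero_nbhd V \<longrightarrow> (\<exists>U\<in>N. U \<subseteq> V)) \<and>
     (\<forall>U\<in>N. balanced U) \<and>
     (\<forall>U\<in>N. \<forall>c. c \<noteq> 0 \<longrightarrow> (*\<^sub>C) c ` U \<in> N) \<and>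
     (\<forall>V\<^sub>1\<in>N. \<forall>V\<^sub>2\<in>N. \<exists>W\<in>N. W \<subseteq> V\<^sub>1 \<inter> V\<^sub>2) \<and>
     (\<forall>V\<in>N. \<exists>U\<in>N. \<forall>x\<in>U. \<forall>y\<in>U. x + y \<in> V) \<and>
     (locally_convex \<longrightarrow> (\<forall>U\<in>N. cvx U))"

definition bounded_set :: "'a set \<Rightarrow> bool" where
  "bounded_set B \<longleftrightarrow>
     (\<forall>V. zero_nbhd V \<longrightarrow> (\<exists>r>0. \<forall>c. r \<le> cmod c \<longrightarrow> B \<subseteq> (*\<^sub>C) c ` V))"

abbreviation linear_op :: "('a \<Rightarrow> 'a) \<Rightarrow> bool" where
  "linear_op T \<equiv> Vector_Spaces.linear (*\<^sub>C) (*\<^sub>C) T"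

definition compact_op :: "('a \<Rightarrow> 'a) \<Rightarrow> bool" where
  "compact_op K \<longleftrightarrow> linear_op K \<and> (\<exists>U. zero_nbhd U \<and> compact (closure (K ` U)))"

definition bb_bounded :: "('a \<Rightarrow> 'a) \<Rightarrow> bool" where
  "bb_bounded T \<longleftrightarrow> (\<forall>B. bounded_set B \<longrightarrow> bounded_set (T ` B))"

definition nn_bounded :: "('a \<Rightarrow> 'a) \<Rightarrow> bool" where
  "nn_bounded T \<longleftrightarrow>
     (\<exists>N. zero_base N \<and> (\<forall>U\<in>N. \<exists>\<alpha>>0. T ` U \<subseteq> (*\<^sub>C) (complex_of_real \<alpha>) ` U))"

definition nb_bounded :: "('a \<Rightarrow> 'a) \<Rightarrow> bool" where
  "nb_bounded T \<longleftrightarrow> (\<exists>U. zero_nbhd U \<and> bounded_set (T ` U))"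

definition scaled_iterate :: "('a \<Rightarrow> 'a) \<Rightarrow> real \<Rightarrow> nat \<Rightarrow> 'a \<Rightarrow> 'a" where
  "scaled_iterate T \<nu> n x = complex_of_real (1 / \<nu> ^ n) *\<^sub>C (T ^^ n) x"

end

text \<open>The four flavours of spectrum and spectral radius: bb, c, nn and nb.\<close>

datatype flavour = BB | Cont | NN | NB

context complex_tvs
begin

text \<open>The property required of an inverse of \<open>\<lambda>I - T\<close>. For nb the inverse itself need not be
  nb-bounded, only up to a scalar multiple of the identity.\<close>

primrec admissible_inverse :: "flavour \<Rightarrow> ('a \<Rightarrow> 'a) \<Rightarrow> bool" where
  "admissible_inverse BB R \<longleftrightarrow> bb_bounded R"
| "admissible_inverse Cont R \<longleftrightarrow> continuous_on UNIV R"
| "admissible_inverse NN R \<longleftrightarrow> nn_bounded R"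
| "admissible_inverse NB R \<longleftrightarrow>
     (\<exists>\<alpha> S. linear_op S \<and> nb_bounded S \<and> R = (\<lambda>x. \<alpha> *\<^sub>C x + S x))"

definition resolvent_set :: "flavour \<Rightarrow> ('a \<Rightarrow> 'a) \<Rightarrow> complex set" where
  "resolvent_set k T = {l. \<exists>R. linear_op R \<and> admissible_inverse k R \<and>
     (\<lambda>x. l *\<^sub>C x - T x) \<circ> R = id \<and> R \<circ> (\<lambda>x. l *\<^sub>C x - T x) = id}"

definition spectrum :: "flavour \<Rightarrow> ('a \<Rightarrow> 'a) \<Rightarrow> complex set" where
  "spectrum k T = - resolvent_set k T"

text \<open>\<open>powers_vanish k T \<nu>\<close> says that \<open>T\<^sup>n / \<nu>\<^sup>n\<close> tends to zero in the sense of the flavour \<open>k\<close>.\<close>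

primrec powers_vanish :: "flavour \<Rightarrow> ('a \<Rightarrow> 'a) \<Rightarrow> real \<Rightarrow> bool" where
  "powers_vanish BB T \<nu> \<longleftrightarrow>
     (\<forall>B. bounded_set B \<longrightarrow> (\<forall>V. zero_nbhd V \<longrightarrow>
        (\<forall>\<^sub>F n in sequentially. scaled_iterate T \<nu> n ` B \<subseteq> V)))"
| "powers_vanish Cont T \<nu> \<longleftrightarrow>
     (\<forall>V. zero_nbhd V \<longrightarrow> (\<exists>U. zero_nbhd U \<and> (\<forall>\<epsilon>>0.
        \<forall>\<^sub>F n in sequentially. scaled_iterate T \<nu> n ` U \<subseteq> (*\<^sub>C) (complex_of_real \<epsilon>) ` V)))"
| "powers_vanish NN T \<nu> \<longleftrightarrow>
     (\<exists>N. zero_base N \<and> (\<forall>U\<in>N. \<forall>\<epsilon>>0.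
        \<forall>\<^sub>F n in sequentially. scaled_iterate T \<nu> n ` U \<subseteq> (*\<^sub>C) (complex_of_real \<epsilon>) ` U))"
| "powers_vanish NB T \<nu> \<longleftrightarrow>
     (\<exists>U. zero_nbhd U \<and> (\<forall>V. zero_nbhd V \<longrightarrow>
        (\<forall>\<^sub>F n in sequentially. scaled_iterate T \<nu> n ` U \<subseteq> V)))"

text \<open>In \<^typ>\<open>ennreal\<close> the infimum of the empty set is \<open>\<infinity>\<close> and its supremum is \<open>0\<close>.\<close>

definition spectral_radius :: "flavour \<Rightarrow> ('a \<Rightarrow> 'a) \<Rightarrow> ennreal" where
  "spectral_radius k T = (INF \<nu>\<in>{\<nu>. 0 < \<nu> \<and> powers_vanish k T \<nu>}. ennreal \<nu>)"

definition geometric_radius :: "flavour \<Rightarrow> ('a \<Rightarrow> 'a) \<Rightarrow> ennreal" where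
  "geometric_radius k T = (SUP l\<in>spectrum k T. ennreal (cmod l))"

end

end

(* Let U be a balanced zero neighborhood with
   K(U) contained in a compact set C. If K^n / nu^n does not tend to zero and 0 < rho < nu, then the
   sets K^n(U) are not contained in M rho^n U for any M. Looking at the first n where this fails,
   for larger and larger M, and passing to a limit by Tychonoff, one gets a sequence y with
   K (y (k + 1)) = y k, y 0 \<noteq> 0 and y k in a fixed multiple of rho^(-k) C. A pigeonhole argument on
   coverings of C by translates of a small multiple of U shows that the shifts of y are linearly
   dependent: a combination of boundedly many of them vanishes identically. Splitting off a root of
   the annihilating polynomial of least degree gives a geometric sequence, whose terms are
   eigenvectors of K for an eigenvalue of modulus at least rho. *)

theory Submission
  imports Defs "HOL-Computational_Algebra.Fundamental_Theorem_Algebra"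
begin

text \<open>Size is measured by multiples of \<open>U\<close> and of \<open>C\<close>.
  \<open>U\<close> may be unbounded, whereas every zero neighborhood absorbs \<open>C\<close>; a
  bound by multiples of \<open>U\<close> becomes a genuine one only after one more application of
  \<open>K\<close>, and this is where most index shifts by one come from.

  \<open>K\<close> moves a backward orbit one index down, so a relation among far terms of
  \<open>y\<close> can be pushed down to all earlier shifts. Hence the pigeonhole argument is run at
  a far index: the integer combinations of \<open>N + 1\<close> consecutive terms outnumber the
  colour patterns met along \<open>s\<close> applications of \<open>K\<close>. Two combinations with
  the same pattern have images that nearly agree. It is decisive that \<open>N\<close> depends on
  the number of colours only and not on the precision wanted: the coefficients, normalised to
  maximal modulus 1, then lie in a fixed compact set, and a cluster point of them is a nontrivial
  exact relation.\<close>

lemma compact_cluster_point: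
  fixes f :: "nat \<Rightarrow> 'b::topological_space"
  assumes "compact S" and "\<And>n. f n \<in> S"
  obtains x where "x \<in> S"
    and "\<And>Q. closed Q \<Longrightarrow> \<forall>\<^sub>F n in sequentially. f n \<in> Q \<Longrightarrow> x \<in> Q"
proof -
  let ?F = "{Q. closed Q \<and> (\<forall>\<^sub>F n in sequentially. f n \<in> Q)}"
  \<comment> \<open>Finitely many closed sets that eventually contain the sequence share one of its
    terms, which is the finite intersection property. The resulting point does the work of the limit
    of a subsequence.\<close>
  have "S \<inter> \<Inter> ?F \<noteq> {}"
  proof (rule compact_imp_fip[OF assms(1)])
    fix F' assume "finite F'" "F' \<subseteq> ?F"
    then have "\<forall>\<^sub>F n in sequentially. \<forall>Q\<in>F'. f n \<in> Q"
      by (auto simp: eventually_ball_finite_distrib)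
    then obtain n where "\<forall>Q\<in>F'. f n \<in> Q"
      using eventually_happens' sequentially_bot by blast
    then show "S \<inter> \<Inter> F' \<noteq> {}"
      using assms(2)[of n] by auto
  qed auto
  then show thesis
    using that by auto
qed

text \<open>Tychonoff's theorem for the product topology on a function type; it serves both for
  sequences of vectors and for sequences of coefficients.\<close>

lemma compact_PiE_UNIV:
  fixes S :: "'i \<Rightarrow> 'b::topological_space set"
  assumes "\<And>i. compact (S i)"
  shows "compact {f. \<forall>i. f i \<in> S i}"
proof -
  have "compactin (product_topology (\<lambda>_. euclidean) UNIV) (PiE UNIV S)"
    using assms by (simp add: compactin_PiE)
  then show ?thesis
    by (simp add: euclidean_product_topology PiE_UNIV_domain Pi_def)
qed

subsection \<open>Zero neighborhoods\<close>

context complex_tvs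
begin

lemma mem_scale_image_iff: "c \<noteq> 0 \<Longrightarrow> x \<in> (*\<^sub>C) c ` U \<longleftrightarrow> inverse c *\<^sub>C x \<in> U"
  by (metis (no_types, lifting) imageE image_eqI left_inverse right_inverse scale_one scale_scale)

lemma continuous_on_scale:
  assumes "continuous_on S f" "continuous_on S g"
  shows "continuous_on S (\<lambda>x. f x *\<^sub>C g x)"
  using continuous_on_compose2[OF continuous_scale continuous_on_Pair[OF assms]] by simp

lemma open_scale_vimage: "open U \<Longrightarrow> open {x. c *\<^sub>C x \<in> U}"
  using open_vimage[OF _ continuous_on_scale[OF continuous_on_const continuous_on_id], of U c]
  by (simp add: vimage_def)

lemma zero_nbhd_mono: "zero_nbhd U \<Longrightarrow> U \<subseteq> V \<Longrightarrow> zero_nbhd V"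
  unfolding zero_nbhd_def using interior_mono by blast

lemma zero_nbhd_Int: "zero_nbhd U \<Longrightarrow> zero_nbhd V \<Longrightarrow> zero_nbhd (U \<inter> V)"
  unfolding zero_nbhd_def by simp

lemma zero_nbhdI: "open S \<Longrightarrow> 0 \<in> S \<Longrightarrow> S \<subseteq> U \<Longrightarrow> zero_nbhd U"
  unfolding zero_nbhd_def using interior_maximal by blast

lemma zero_nbhd_scale_image:
  assumes "zero_nbhd U" "c \<noteq> 0"
  shows "zero_nbhd ((*\<^sub>C) c ` U)"
proof (rule zero_nbhdI)
  show "open {x. inverse c *\<^sub>C x \<in> interior U}"
    by (rule open_scale_vimage) simp
qed (use assms interior_subset[of U] in \<open>auto simp: zero_nbhd_def mem_scale_image_iff\<close>)

lemma balanced_scale_mem: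
  assumes "balanced U" "u \<in> U" "cmod a \<le> cmod d"
  shows "a *\<^sub>C u \<in> (*\<^sub>C) d ` U"
proof (cases "d = 0")
  case True
  then show ?thesis using assms by auto
next
  case False
  have "(a / d) *\<^sub>C u \<in> U"
    using assms False unfolding balanced_def by (force simp: norm_divide divide_le_eq_1)
  then have "d *\<^sub>C ((a / d) *\<^sub>C u) \<in> (*\<^sub>C) d ` U" by blast
  then show ?thesis using False by simp
qed

lemma balanced_mem: "balanced U \<Longrightarrow> u \<in> U \<Longrightarrow> cmod a \<le> 1 \<Longrightarrow> a *\<^sub>C u \<in> U"
  unfolding balanced_def by blast

lemma scale_image_balanced_mono:
  assumes "balanced U" "cmod c \<le> cmod d"
  shows "(*\<^sub>C) c ` U \<subseteq> (*\<^sub>C) d ` U"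
  using balanced_scale_mem[OF assms(1) _ assms(2)] by blast

lemma balanced_nbhd_subset:
  assumes "zero_nbhd V"
  obtains W where "zero_nbhd W" "balanced W" "W \<subseteq> V"
proof -
  have "open ((\<lambda>p. fst p *\<^sub>C snd p) -` interior V)"
    by (intro open_vimage continuous_scale) simp
  moreover have "(0, 0) \<in> (\<lambda>p. fst p *\<^sub>C snd p) -` interior V"
    using assms by (simp add: zero_nbhd_def)
  ultimately obtain A B where AB: "open A" "open B" "(0, 0) \<in> A \<times> B"
      "A \<times> B \<subseteq> (\<lambda>p. fst p *\<^sub>C snd p) -` interior V"
    by (rule open_prod_elim)
  obtain r where r: "r > 0" "ball 0 r \<subseteq> A"
    using AB open_contains_ball[of A] by auto
  \<comment> \<open>Joint continuity of scaling at \<open>(0, 0)\<close> keeps these products in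
    \<open>V\<close>. Admitting every scalar of modulus below \<open>r\<close> makes
    \<open>W\<close> balanced, and the single scalar \<open>r / 2\<close> already makes it a
    neighborhood.\<close>
  define W where "W = {c *\<^sub>C x | c x. cmod c < r \<and> x \<in> B}"
  have "W \<subseteq> V"
  proof
    fix w assume "w \<in> W"
    then obtain c x where cx: "w = c *\<^sub>C x" "cmod c < r" "x \<in> B"
      unfolding W_def by blast
    then have "(c, x) \<in> A \<times> B" using r by auto
    then show "w \<in> V" using subsetD[OF AB(4), of "(c, x)"] interior_subset[of V] cx by auto
  qed
  moreover have "balanced W"
    unfolding balanced_def
  proof safe
    fix d w assume "cmod d \<le> 1" "w \<in> W"
    then obtain c x where cx: "w = c *\<^sub>C x" "cmod c < r" "x \<in> B"
      unfolding W_def by blast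
    have "cmod d * cmod c \<le> 1 * cmod c"
      using \<open>cmod d \<le> 1\<close> by (intro mult_right_mono) auto
    then have "cmod (d * c) < r" using cx by (simp add: norm_mult)
    then show "d *\<^sub>C w \<in> W" unfolding W_def using cx by auto
  qed
  moreover have "zero_nbhd W"
  proof (rule zero_nbhd_mono)
    show "zero_nbhd ((*\<^sub>C) (complex_of_real (r / 2)) ` B)"
      using AB r by (intro zero_nbhd_scale_image) (auto simp: zero_nbhd_def interior_open)
    show "(*\<^sub>C) (complex_of_real (r / 2)) ` B \<subseteq> W"
      unfolding W_def using r by force
  qed
  ultimately show thesis using that by blast
qed

lemma half_nbhd:
  assumes "zero_nbhd V"
  obtains W where "zero_nbhd W" "balanced W" "\<And>x y. x \<in> W \<Longrightarrow> y \<in> W \<Longrightarrow> x + y \<in> V"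
proof -
  have "open ((\<lambda>p. fst p + snd p) -` interior V)"
    by (intro open_vimage continuous_intros) simp
  moreover have "(0, 0) \<in> (\<lambda>p. fst p + snd p) -` interior V"
    using assms by (simp add: zero_nbhd_def)
  ultimately obtain A B where AB: "open A" "open B" "(0, 0) \<in> A \<times> B"
      "A \<times> B \<subseteq> (\<lambda>p. fst p + snd p) -` interior V"
    by (rule open_prod_elim)
  have "zero_nbhd (A \<inter> B)"
    using AB by (intro zero_nbhdI[of "A \<inter> B"]) auto
  then obtain W where W: "zero_nbhd W" "balanced W" "W \<subseteq> A \<inter> B"
    using balanced_nbhd_subset by blast
  show thesis
  proof (rule that[OF W(1,2)])
    fix x y assume "x \<in> W" "y \<in> W"
    then have "(x, y) \<in> A \<times> B" using W by auto
    then show "x + y \<in> V" using subsetD[OF AB(4), of "(x, y)"] interior_subset[of V] by auto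
  qed
qed

text \<open>Repeated halving replaces the triangle inequality. \<open>W\<close> depends only on
  \<open>V\<close> and the number of summands, so the bound is uniform in the family
  \<open>w\<close>.\<close>

lemma sum_nbhd:
  assumes "zero_nbhd V"
  shows "\<exists>W. zero_nbhd W \<and> balanced W \<and> (\<forall>w. (\<forall>i\<le>n. w i \<in> W) \<longrightarrow> (\<Sum>i\<le>n::nat. w i) \<in> V)"
  using assms
proof (induction n arbitrary: V)
  case 0
  then obtain W where "zero_nbhd W" "balanced W" "W \<subseteq> V"
    by (rule balanced_nbhd_subset)
  then show ?case by auto
next
  case (Suc n)
  obtain V' where V': "zero_nbhd V'" "\<And>x y. x \<in> V' \<Longrightarrow> y \<in> V' \<Longrightarrow> x + y \<in> V"
    using half_nbhd[OF Suc.prems] by metis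
  obtain W where W: "zero_nbhd W" "\<And>w. \<forall>i\<le>n. w i \<in> W \<Longrightarrow> (\<Sum>i\<le>n. w i) \<in> V'"
    using Suc.IH[OF V'(1)] by blast
  obtain W' where "zero_nbhd W'" "balanced W'" "W' \<subseteq> W \<inter> V'"
    using balanced_nbhd_subset[OF zero_nbhd_Int[OF W(1) V'(1)]] by blast
  then show ?case
    using V'(2) W(2) by (intro exI[of _ W']) (auto simp: subset_iff)
qed

text \<open>Each \<open>x\<close> divided by \<open>n + 1\<close> tends to 0, so the open sets
  \<open>P n\<close> cover \<open>C\<close>. As \<open>V\<close> is balanced, the largest index of a
  finite subcover serves for all points.\<close>

lemma compact_absorbed:
  assumes "compact C" "zero_nbhd V" "balanced V"
  obtains t where "t > 0" "C \<subseteq> (*\<^sub>C) (complex_of_real t) ` V"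
proof -
  define P where "P n = {x. complex_of_real (1 / (real n + 1)) *\<^sub>C x \<in> interior V}" for n :: nat
  have "C \<subseteq> (\<Union>n\<in>UNIV. P n)"
  proof
    fix x assume "x \<in> C"
    have "isCont (\<lambda>c. c *\<^sub>C x) 0"
      using continuous_on_scale[OF continuous_on_id continuous_on_const[of UNIV x]]
      by (simp add: continuous_on_eq_continuous_at)
    moreover have "(\<lambda>n. complex_of_real (1 / (real n + 1))) \<longlonglongrightarrow> 0"
      using tendsto_of_real[OF LIMSEQ_inverse_real_of_nat, where ?'a = complex] by (simp add: field_simps)
    ultimately have "(\<lambda>n. complex_of_real (1 / (real n + 1)) *\<^sub>C x) \<longlonglongrightarrow> 0 *\<^sub>C x"
      by (rule isCont_tendsto_compose)
    then have "\<forall>\<^sub>F n in sequentially. complex_of_real (1 / (real n + 1)) *\<^sub>C x \<in> interior V"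
      using assms(2) by (intro topological_tendstoD) (auto simp: zero_nbhd_def)
    then show "x \<in> (\<Union>n\<in>UNIV. P n)"
      unfolding P_def using eventually_happens' sequentially_bot by force
  qed
  then obtain I where I: "finite I" "C \<subseteq> (\<Union>n\<in>I. P n)"
    using compactE_image[OF assms(1), of UNIV P] unfolding P_def
    by (metis open_interior open_scale_vimage)
  define t where "t = real (Max (insert 0 I)) + 1"
  have t: "t > 0" unfolding t_def by simp
  have "C \<subseteq> (*\<^sub>C) (complex_of_real t) ` V"
  proof
    fix x assume "x \<in> C"
    then obtain n where n: "n \<in> I" "x \<in> P n" using I by blast
    then have "complex_of_real (1 / (real n + 1)) *\<^sub>C x \<in> V"
      unfolding P_def using interior_subset by blast
    moreover have "real n + 1 \<le> t"
      unfolding t_def using I(1) n(1) by simp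
    ultimately have "complex_of_real (real n + 1) *\<^sub>C complex_of_real (1 / (real n + 1)) *\<^sub>C x
        \<in> (*\<^sub>C) (complex_of_real t) ` V"
      using t by (intro balanced_scale_mem[OF assms(3)]) (auto simp: norm_of_real simp del: of_real_add)
    then show "x \<in> (*\<^sub>C) (complex_of_real t) ` V"
      by (simp flip: of_real_mult del: of_real_add of_real_divide)
  qed
  with t show thesis using that by blast
qed

end

subsection \<open>Compact operators and backward orbits\<close>

locale compact_operator = complex_tvs scale
  for scale :: "complex \<Rightarrow> 'a::{topological_ab_group_add, t2_space} \<Rightarrow> 'a" (infixr "*\<^sub>C" 75) +
  fixes K :: "'a \<Rightarrow> 'a" and U C :: "'a set"
  assumes linear: "linear_op K"
    and nbhd: "zero_nbhd U"
    and balanced: "balanced U"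
    and compact: "compact C"
    and image: "K ` U \<subseteq> C"
begin

sublocale K: Vector_Spaces.linear scale scale K
  by (fact linear)

lemma zero_in_nbhd: "zero_nbhd V \<Longrightarrow> 0 \<in> V"
  unfolding zero_nbhd_def using interior_subset by blast

lemma image_scaled: "x \<in> (*\<^sub>C) c ` U \<Longrightarrow> K x \<in> (*\<^sub>C) c ` C"
  using image by (fastforce simp: K.scale)

lemma eq_zero_if_in_all_nbhds:
  assumes "\<And>V. zero_nbhd V \<Longrightarrow> x \<in> V"
  shows "(x::'a) = 0"
proof (rule ccontr)
  assume "x \<noteq> 0"
  then have "zero_nbhd (- {x})"
    by (intro zero_nbhdI[of "- {x}"]) auto
  then show False using assms by blast
qed

text \<open>This plays the role of a norm bound on \<open>C\<close>: with respect to
  \<open>V\<close>, elements of \<open>C\<close> behave like vectors of norm at most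
  \<open>t\<close>.\<close>

lemma C_absorbed:
  assumes "zero_nbhd V"
  obtains t where "t > 0" "\<And>c u. u \<in> C \<Longrightarrow> cmod c * t \<le> 1 \<Longrightarrow> c *\<^sub>C u \<in> V"
proof -
  obtain W where W: "zero_nbhd W" "balanced W" "W \<subseteq> V"
    using balanced_nbhd_subset[OF assms] .
  obtain t where t: "t > 0" "C \<subseteq> (*\<^sub>C) (complex_of_real t) ` W"
    using compact_absorbed[OF compact W(1,2)] .
  show thesis
  proof (rule that[OF t(1)])
    fix c u assume "u \<in> C" and c: "cmod c * t \<le> 1"
    then obtain w where w: "w \<in> W" "u = complex_of_real t *\<^sub>C w" using t by blast
    have "(c * complex_of_real t) *\<^sub>C w \<in> W"
      using c t(1) w(1) W(2) by (intro balanced_mem) (auto simp: norm_mult)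
    then show "c *\<^sub>C u \<in> V" using w W by auto
  qed
qed

text \<open>\<open>K\<close> maps small multiples of \<open>U\<close> into small multiples of
  \<open>C\<close>, which lie in any prescribed zero neighborhood; linearity carries this from 0 to
  an arbitrary point \<open>x\<close>.\<close>

lemma continuous: "continuous_on UNIV K"
  unfolding continuous_on_open_vimage[OF open_UNIV]
proof safe
  fix B :: "'a set" assume B: "open B"
  show "open (K -` B \<inter> UNIV)"
  proof (subst open_subopen, intro ballI)
    fix x assume x: "x \<in> K -` B \<inter> UNIV"
    have "open ((\<lambda>v. K x + v) -` B)"
      by (intro open_vimage B continuous_intros)
    then have "zero_nbhd ((\<lambda>v. K x + v) -` B)"
      using x by (intro zero_nbhdI) auto
    then obtain t where t: "t > 0" "\<And>c u. u \<in> C \<Longrightarrow> cmod c * t \<le> 1 \<Longrightarrow> c *\<^sub>C u \<in> (\<lambda>v. K x + v) -` B"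
      by (rule C_absorbed) blast
    define T where "T = (\<lambda>z. complex_of_real t *\<^sub>C (z - x)) -` interior U"
    have "open T" unfolding T_def
      by (intro open_vimage continuous_on_scale continuous_intros) simp
    moreover have "x \<in> T" unfolding T_def using nbhd by (simp add: zero_nbhd_def)
    moreover have "T \<subseteq> K -` B \<inter> UNIV"
    proof
      fix z assume "z \<in> T"
      then have "complex_of_real t *\<^sub>C (z - x) \<in> U"
        unfolding T_def using interior_subset by blast
      then have "K (complex_of_real t *\<^sub>C (z - x)) \<in> C" using image by blast
      then have "complex_of_real (1/t) *\<^sub>C K (complex_of_real t *\<^sub>C (z - x)) \<in> (\<lambda>v. K x + v) -` B"
        using t(1) by (intro t(2)) (auto simp: norm_divide)
      moreover have "complex_of_real (1/t) *\<^sub>C K (complex_of_real t *\<^sub>C (z - x)) = K z - K x"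
        using t(1) by (simp add: K.scale K.diff)
      ultimately show "z \<in> K -` B \<inter> UNIV" by simp
    qed
    ultimately show "\<exists>T. open T \<and> x \<in> T \<and> T \<subseteq> K -` B \<inter> UNIV" by blast
  qed
qed

section \<open>Finite colourings of the compact set and linear dependence of the shifts\<close>

lemma finite_colouring:
  fixes \<delta> :: real
  assumes "\<delta> > 0"
  obtains F and colour :: "'a \<Rightarrow> 'a" where "finite F" "\<And>x. x \<in> C \<Longrightarrow> colour x \<in> F"
    "\<And>x x'. x \<in> C \<Longrightarrow> x' \<in> C \<Longrightarrow> colour x = colour x' \<Longrightarrow> x - x' \<in> (*\<^sub>C) (complex_of_real \<delta>) ` U"
proof -
  have "zero_nbhd ((*\<^sub>C) (complex_of_real \<delta>) ` U)"
    using nbhd assms by (intro zero_nbhd_scale_image) auto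
  then obtain W where W: "zero_nbhd W" "balanced W"
      "\<And>x y. x \<in> W \<Longrightarrow> y \<in> W \<Longrightarrow> x + y \<in> (*\<^sub>C) (complex_of_real \<delta>) ` U"
    by (rule half_nbhd) blast
  define P where "P f = (\<lambda>x. x - f) -` interior W" for f
  have "open (P f)" for f unfolding P_def
    by (intro open_vimage continuous_intros) simp
  moreover have "C \<subseteq> (\<Union>f\<in>C. P f)"
    using W(1) by (auto simp: P_def zero_nbhd_def)
  ultimately obtain F where F: "F \<subseteq> C" "finite F" "C \<subseteq> (\<Union>f\<in>F. P f)"
    using compactE_image[OF compact, of C P] by blast
  \<comment> \<open>A colour is the centre of a translate of \<open>W\<close> containing
    \<open>x\<close>. Points of the same translate differ by an element of \<open>W - W\<close>,
    which lies in \<open>\<delta>\<close> times \<open>U\<close> because \<open>W\<close> is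
    balanced.\<close>
  define colour where "colour x = (SOME f. f \<in> F \<and> x \<in> P f)" for x
  have colour: "colour x \<in> F \<and> x \<in> P (colour x)" if "x \<in> C" for x
    unfolding colour_def using F that by (intro someI_ex[of "\<lambda>f. f \<in> F \<and> x \<in> P f"]) blast
  show thesis
  proof (rule that[OF F(2)])
    show "colour x \<in> F" if "x \<in> C" for x using colour that by blast
    show "x - x' \<in> (*\<^sub>C) (complex_of_real \<delta>) ` U"
      if "x \<in> C" "x' \<in> C" "colour x = colour x'" for x x'
    proof -
      have *: "x - colour x \<in> W" "x' - colour x \<in> W"
        using colour[OF that(1)] colour[OF that(2)] that(3) interior_subset[of W] by (auto simp: P_def)
      have "(-1) *\<^sub>C (x' - colour x) \<in> W"
        by (rule balanced_mem[OF W(2) *(2)]) simp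
      then have "(x - colour x) + (-1) *\<^sub>C (x' - colour x) \<in> (*\<^sub>C) (complex_of_real \<delta>) ` U"
        by (rule W(3)[OF *(1)])
      then show ?thesis by simp
    qed
  qed
qed

text \<open>Each application of \<open>K\<close> trades points for closeness: after rescaling, the
  images lie in \<open>C\<close>, and the largest colour class keeps at least the fraction
  \<open>1 / card F\<close> of the points while their differences gain the factor
  \<open>\<delta>\<close>. With more than \<open>card F ^ s\<close> points, two are left after
  \<open>s\<close> rounds.\<close>

lemma close_pair_of_iterates:
  fixes \<delta> r :: real and x :: "'i \<Rightarrow> 'a"
  assumes F: "finite F" "\<And>x. x \<in> C \<Longrightarrow> colour x \<in> F"
    and colour: "\<And>x x'. x \<in> C \<Longrightarrow> x' \<in> C \<Longrightarrow> colour x = colour x' \<Longrightarrow>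
      x - x' \<in> (*\<^sub>C) (complex_of_real \<delta>) ` U"
    and "\<delta> > 0" "r > 0" "finite A" "card A > card F ^ s"
    and "\<And>a b. a \<in> A \<Longrightarrow> b \<in> A \<Longrightarrow> x a - x b \<in> (*\<^sub>C) (complex_of_real r) ` U"
  shows "\<exists>a\<in>A. \<exists>b\<in>A. a \<noteq> b \<and>
    (K ^^ s) (x a) - (K ^^ s) (x b) \<in> (*\<^sub>C) (complex_of_real (r * \<delta> ^ s)) ` U"
  using assms(5-)
proof (induction s arbitrary: A r x)
  case 0
  then obtain a where a: "a \<in> A" by fastforce
  moreover have "A \<noteq> {a}" using 0 by auto
  ultimately obtain b where "b \<in> A" "a \<noteq> b" by blast
  with a 0(4) show ?case by force
next
  case (Suc s)
  obtain a0 where a0: "a0 \<in> A" using Suc.prems(3) by fastforce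
  \<comment> \<open>Only differences of the points are known to lie in \<open>r\<close> times
    \<open>U\<close>. Subtracting a base point makes \<open>h a\<close> the image under
    \<open>K\<close> of an element of \<open>U\<close>, hence a point of \<open>C\<close> that has a
    colour.\<close>
  define h where "h a = complex_of_real (1/r) *\<^sub>C (K (x a) - K (x a0))" for a
  have h: "h a \<in> C" if a: "a \<in> A" for a
  proof -
    obtain u where u: "u \<in> U" "x a - x a0 = complex_of_real r *\<^sub>C u"
      using Suc.prems(4)[OF a a0] by blast
    have "h a = complex_of_real (1/r) *\<^sub>C K (x a - x a0)"
      unfolding h_def by (simp add: K.diff)
    also have "\<dots> = K u"
      using Suc.prems(1) by (simp add: K.scale u)
    finally have "h a = K u" .
    then show ?thesis using u image by blast
  qed
  have "F \<noteq> {}" using F(2) h a0 by blast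
  then obtain f where f: "card ((colour \<circ> h) -` {f} \<inter> A) * card F \<ge> card A"
    using pigeonhole_card[of "colour \<circ> h" A F] F h Suc.prems(2) by fastforce
  define A' where "A' = (colour \<circ> h) -` {f} \<inter> A"
  have "card F ^ s * card F < card A' * card F"
    using less_le_trans[OF Suc.prems(3) f] by (simp only: A'_def power_Suc2)
  then have 1: "card F ^ s < card A'" by simp
  have 2: "finite A'" unfolding A'_def using Suc.prems by simp
  have 3: "0 < r * \<delta>" using Suc.prems \<open>\<delta> > 0\<close> by simp
  have 4: "K (x a) - K (x b) \<in> (*\<^sub>C) (complex_of_real (r * \<delta>)) ` U"
    if "a \<in> A'" "b \<in> A'" for a b
  proof -
    have "h a - h b \<in> (*\<^sub>C) (complex_of_real \<delta>) ` U"
      using that h by (intro colour) (auto simp: A'_def)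
    then obtain u where u: "u \<in> U" "h a - h b = complex_of_real \<delta> *\<^sub>C u" by blast
    have "K (x a) - K (x b) = complex_of_real r *\<^sub>C (h a - h b)"
      using Suc.prems(1) unfolding h_def by (simp flip: scale_right_diff_distrib)
    then show ?thesis using u by auto
  qed
  have "\<exists>a\<in>A'. \<exists>b\<in>A'. a \<noteq> b \<and>
     (K ^^ s) (K (x a)) - (K ^^ s) (K (x b)) \<in> (*\<^sub>C) (complex_of_real (r * \<delta> * \<delta> ^ s)) ` U"
    using Suc.IH[OF 3 2 1 4] .
  then show ?case
    unfolding A'_def by (auto simp: funpow_swap1 mult.assoc)
qed

text \<open>The model is \<open>y k = l^(-k) v\<close> for an eigenvector \<open>v\<close> whose
  eigenvalue \<open>l\<close> has modulus at least \<open>\<rho>\<close>. Multiples of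
  \<open>C\<close> rather than of \<open>U\<close> are used since only these are controlled by every
  zero neighborhood.\<close>

definition backward_orbit :: "real \<Rightarrow> (nat \<Rightarrow> 'a) \<Rightarrow> bool" where
  "backward_orbit \<rho> y \<longleftrightarrow> (\<forall>k. K (y (Suc k)) = y k) \<and>
     (\<exists>t>0. \<forall>k. y k \<in> (*\<^sub>C) (complex_of_real (t / \<rho> ^ k)) ` C)"

text \<open>The point is the order of the quantifiers: one \<open>t\<close> serves for all
  coefficients of modulus at most \<open>R\<close> and for all positions \<open>k\<close>.\<close>

lemma backward_orbit_combination_bound:
  assumes "backward_orbit \<rho> y" "\<rho> > 0" "R > 0"
  obtains t where "t > 0"
    "\<And>c k. (\<And>i. i \<le> N \<Longrightarrow> cmod (c i) \<le> R) \<Longrightarrow>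
       (\<Sum>i\<le>N. c i *\<^sub>C y (k + i)) \<in> (*\<^sub>C) (complex_of_real (t / \<rho> ^ k)) ` U"
proof -
  obtain t where t: "t > 0" "\<And>k. y k \<in> (*\<^sub>C) (complex_of_real (t / \<rho> ^ k)) ` C"
    using assms(1) unfolding backward_orbit_def by blast
  obtain W where W: "zero_nbhd W" "balanced W" "\<And>w. \<forall>i\<le>N. w i \<in> W \<Longrightarrow> (\<Sum>i\<le>N. w i) \<in> U"
    using sum_nbhd[OF nbhd] by blast
  obtain t0 where t0: "t0 > 0" "\<And>c u. u \<in> C \<Longrightarrow> cmod c * t0 \<le> 1 \<Longrightarrow> c *\<^sub>C u \<in> W"
    using C_absorbed[OF W(1)] by blast
  \<comment> \<open>This bounds \<open>1 / \<rho> ^ i\<close> for all \<open>i \<le> N\<close> at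
    once, whether \<open>\<rho>\<close> is below or above 1.\<close>
  define D where "D = (1 + 1 / \<rho>) ^ N"
  have D: "D > 0" unfolding D_def using assms(2) by (simp add: add_pos_pos)
  have D_ge: "1 / \<rho> ^ i \<le> D" if "i \<le> N" for i
  proof -
    have "1 / \<rho> ^ i \<le> (1 + 1 / \<rho>) ^ i"
      unfolding power_one_over[symmetric] using assms(2) by (intro power_mono) auto
    also have "\<dots> \<le> D" unfolding D_def
      using that assms(2) by (intro power_increasing) auto
    finally show ?thesis .
  qed
  define T where "T = t * R * D * t0"
  have T: "T > 0" unfolding T_def using t t0 D assms by simp
  show thesis
  proof (rule that[OF T])
    fix c k assume c: "\<And>i. i \<le> N \<Longrightarrow> cmod (c i) \<le> R"
    define q where "q = complex_of_real (T / \<rho> ^ k)"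
    have q: "q \<noteq> 0" unfolding q_def using T assms(2) by simp
    have "inverse q *\<^sub>C (c i *\<^sub>C y (k + i)) \<in> W" if i: "i \<le> N" for i
    proof -
      obtain u where u: "u \<in> C" "y (k + i) = complex_of_real (t / \<rho> ^ (k + i)) *\<^sub>C u"
        using t(2) by blast
      have "cmod (inverse q * c i * complex_of_real (t / \<rho> ^ (k + i))) * t0
          = cmod (c i) * (1 / \<rho> ^ i) / (R * D)"
        unfolding q_def T_def using t(1) t0(1) assms D
        by (simp add: norm_mult norm_divide norm_inverse norm_power power_add field_simps)
      also have "\<dots> \<le> R * D / (R * D)"
        using c[OF i] D_ge[OF i] assms D by (intro divide_right_mono mult_mono) auto
      also have "\<dots> = 1" using assms D by simp
      finally have "(inverse q * c i * complex_of_real (t / \<rho> ^ (k + i))) *\<^sub>C u \<in> W"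
        by (intro t0(2) u(1))
      then show ?thesis by (simp add: u mult.assoc)
    qed
    then have "(\<Sum>i\<le>N. inverse q *\<^sub>C (c i *\<^sub>C y (k + i))) \<in> U"
      by (intro W(3)) blast
    then show "(\<Sum>i\<le>N. c i *\<^sub>C y (k + i)) \<in> (*\<^sub>C) (complex_of_real (T / \<rho> ^ k)) ` U"
      unfolding q_def[symmetric] mem_scale_image_iff[OF q] by (simp only: scale_sum_right)
  qed
qed

text \<open>On the terms of the orbit \<open>K\<close> acts as an index shift, hence also on
  combinations with fixed coefficients.\<close>

lemma funpow_combination:
  assumes "\<And>k. K (y (Suc k)) = y k"
  shows "(K ^^ p) (\<Sum>i\<le>N. c i *\<^sub>C y (k + p + i)) = (\<Sum>i\<le>N. c i *\<^sub>C y (k + i))"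
  using assms by (induction p) (simp_all add: K.sum K.scale funpow_swap1)

lemma funpow_image:
  assumes "t1 > 0" "C \<subseteq> (*\<^sub>C) (complex_of_real t1) ` U" "x \<in> (*\<^sub>C) (complex_of_real \<epsilon>) ` U"
  shows "(K ^^ p) x \<in> (*\<^sub>C) (complex_of_real (\<epsilon> * t1 ^ p)) ` U"
proof (induction p)
  case 0
  then show ?case using assms by simp
next
  case (Suc p)
  then obtain u where u: "u \<in> C" "(K ^^ Suc p) x = complex_of_real (\<epsilon> * t1 ^ p) *\<^sub>C u"
    using image_scaled[OF Suc] by auto
  then obtain v where "v \<in> U" "u = complex_of_real t1 *\<^sub>C v" using assms(2) by blast
  then show ?case using u by (auto simp: image_iff mult_ac intro!: bexI[of _ v])
qed

text \<open>\<open>N\<close> precedes \<open>J\<close>, so the number of coefficients stays fixed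
  while the error tends to 0 and the number of shifts covered grows. The normalisation of the
  coefficients keeps the relation from degenerating in the limit.\<close>

lemma approximate_relation:
  assumes y: "backward_orbit \<rho> y" and \<rho>: "\<rho> > 0"
  shows "\<exists>N. \<forall>J. \<exists>c. (\<exists>i\<le>N. cmod (c i) = 1) \<and> (\<forall>i. cmod (c i) \<le> 1) \<and>
    (\<forall>j<J. (\<Sum>i\<le>N. c i *\<^sub>C y (j + i)) \<in> (*\<^sub>C) (complex_of_real ((1/2) ^ J)) ` C)"
proof -
  have shift: "\<And>k. K (y (Suc k)) = y k"
    using y unfolding backward_orbit_def by blast
  have "\<rho> / 4 > 0" using \<rho> by simp
  then obtain F and colour :: "'a \<Rightarrow> 'a" where F: "finite F" "\<And>x. x \<in> C \<Longrightarrow> colour x \<in> F"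
    and colour: "\<And>x x'. x \<in> C \<Longrightarrow> x' \<in> C \<Longrightarrow> colour x = colour x' \<Longrightarrow>
      x - x' \<in> (*\<^sub>C) (complex_of_real (\<rho> / 4)) ` U"
    by (rule finite_colouring) blast
  define N where "N = card F"
  obtain t where t: "t > 0" "\<And>c k. (\<And>i. i \<le> N \<Longrightarrow> cmod (c i) \<le> 1) \<Longrightarrow>
       (\<Sum>i\<le>N. c i *\<^sub>C y (k + i)) \<in> (*\<^sub>C) (complex_of_real (t / \<rho> ^ k)) ` U"
    by (rule backward_orbit_combination_bound[OF y \<rho> zero_less_one]) blast
  obtain t0 where t0: "t0 > 0" "C \<subseteq> (*\<^sub>C) (complex_of_real t0) ` U"
    using compact_absorbed[OF compact nbhd balanced] .
  \<comment> \<open>With \<open>t1\<close> at least 1, the loss \<open>t1 ^ p\<close> of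
    \<open>p \<le> J\<close> further applications of \<open>K\<close> is at most
    \<open>t1 ^ J\<close>.\<close>
  define t1 where "t1 = max 1 t0"
  have t1: "t1 \<ge> 1" "C \<subseteq> (*\<^sub>C) (complex_of_real t1) ` U"
    using t0 scale_image_balanced_mono[OF balanced, of "complex_of_real t0" "complex_of_real t1"]
    unfolding t1_def by auto
  show ?thesis
  proof (intro exI[of _ N] allI)
    fix J
    \<comment> \<open>There are more than \<open>(2 ^ s) ^ N\<close> combinations with coefficients in \<open>{0..2 ^ s}\<close>, but only
      \<open>card F ^ s \<le> (2 ^ N) ^ s\<close> colour patterns. The gain \<open>(\<rho> / 4) ^ s\<close> beats the loss \<open>2 ^ s / \<rho> ^ s\<close>.\<close>
    define B where "B = t * t1 ^ J / \<rho> ^ J * 2 ^ J"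
    obtain s where s: "B < 2 ^ s"
      using real_arch_pow[of 2 B] by auto
    define A where "A = PiE {..N} (\<lambda>_. {..(2::nat) ^ s})"
    have finA: "finite A" unfolding A_def by (intro finite_PiE) auto
    have "card F ^ s \<le> (2 ^ N) ^ s"
      unfolding N_def by (intro power_mono[OF less_imp_le[OF less_exp]]) simp
    also have "\<dots> \<le> (2 ^ s) ^ (Suc N)"
      by (simp flip: power_mult add: mult.commute)
    also have "\<dots> < (Suc (2 ^ s)) ^ (Suc N)"
      by (intro power_strict_mono) auto
    also have "\<dots> = card A"
      unfolding A_def by (simp add: card_PiE)
    finally have cardA: "card A > card F ^ s" .
    define x where "x a = (\<Sum>i\<le>N. of_nat (a i) *\<^sub>C y (J + s + i))" for a :: "nat \<Rightarrow> nat"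
    define r where "r = 2 ^ s * (t / \<rho> ^ (J + s))"
    have r: "r > 0" unfolding r_def using t \<rho> by simp
    have diff: "x a - x b = (\<Sum>i\<le>N. (of_nat (a i) - of_nat (b i)) *\<^sub>C y (J + s + i))" for a b
      unfolding x_def by (simp add: sum_subtractf scale_left_diff_distrib)
    have small: "x a - x b \<in> (*\<^sub>C) (complex_of_real r) ` U" if "a \<in> A" "b \<in> A" for a b
    proof -
      have "(\<Sum>i\<le>N. ((of_nat (a i) - of_nat (b i)) / 2 ^ s) *\<^sub>C y (J + s + i))
          \<in> (*\<^sub>C) (complex_of_real (t / \<rho> ^ (J + s))) ` U"
      proof (rule t(2))
        fix i assume i: "i \<le> N"
        have "a i \<le> 2 ^ s" "b i \<le> 2 ^ s" using that i unfolding A_def by (auto simp: PiE_iff)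
        then have "real (a i) \<le> 2 ^ s" "real (b i) \<le> 2 ^ s" 
          using of_nat_mono[of "a i" "2 ^ s", where 'a = real] of_nat_mono[of "b i" "2 ^ s", where 'a = real] by simp_all
        then have "\<bar>real (a i) - real (b i)\<bar> \<le> 2 ^ s" unfolding abs_le_iff by linarith
        moreover have "cmod (of_nat (a i) - of_nat (b i)) = \<bar>real (a i) - real (b i)\<bar>"
          unfolding norm_of_real[symmetric, where 'a = complex] by simp
        ultimately show "cmod ((of_nat (a i) - of_nat (b i)) / 2 ^ s) \<le> 1"
          by (simp add: norm_divide norm_power)
      qed
      then obtain u where u: "u \<in> U" "(\<Sum>i\<le>N. ((of_nat (a i) - of_nat (b i)) / 2 ^ s) *\<^sub>C y (J + s + i))
          = complex_of_real (t / \<rho> ^ (J + s)) *\<^sub>C u" by blast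
      have "x a - x b = (2 ^ s) *\<^sub>C (\<Sum>i\<le>N. ((of_nat (a i) - of_nat (b i)) / 2 ^ s) *\<^sub>C y (J + s + i))"
        unfolding diff by (simp add: scale_sum_right)
      also have "\<dots> = complex_of_real r *\<^sub>C u"
        unfolding u r_def by simp
      finally show ?thesis using u by blast
    qed
    have "\<exists>a\<in>A. \<exists>b\<in>A. a \<noteq> b \<and>
        (K ^^ s) (x a) - (K ^^ s) (x b) \<in> (*\<^sub>C) (complex_of_real (r * (\<rho> / 4) ^ s)) ` U"
      by (rule close_pair_of_iterates[where colour = colour and F = F])
        (fact F colour \<open>\<rho> / 4 > 0\<close> r finA cardA small)+
    then obtain a b where ab: "a \<in> A" "b \<in> A" "a \<noteq> b"
        "(K ^^ s) (x a) - (K ^^ s) (x b) \<in> (*\<^sub>C) (complex_of_real (r * (\<rho> / 4) ^ s)) ` U"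
      by blast
    define d where "d i = complex_of_real (real (a i) - real (b i))" for i
    obtain i0 where i0: "i0 \<le> N" "a i0 \<noteq> b i0"
      using ab(1-3) PiE_ext[of a "{..N}" _ b] unfolding A_def by blast
    \<comment> \<open>The \<open>d i\<close> are integers, not all zero, so
      \<open>m \<ge> 1\<close>: dividing by \<open>m\<close> makes the largest coefficient have
      modulus 1 and does not enlarge the combination.\<close>
    define m where "m = Max ((\<lambda>i. cmod (d i)) ` {..N})"
    have m_ge: "cmod (d i) \<le> m" if "i \<le> N" for i unfolding m_def using that by simp
    have "m \<in> (\<lambda>i. cmod (d i)) ` {..N}" unfolding m_def by (intro Max_in) auto
    then obtain i1 where i1: "i1 \<le> N" "cmod (d i1) = m" by auto
    have "1 \<le> cmod (d i0)" unfolding d_def norm_of_real using i0(2) by linarith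
    then have m1: "m \<ge> 1" using m_ge[OF i0(1)] by linarith
    \<comment> \<open>The value 0 beyond \<open>N\<close> makes the bound
      \<open>cmod (c i) \<le> 1\<close> hold for every index, so that \<open>c\<close> is a point of
      a product of closed discs.\<close>
    define c where "c i = (if i \<le> N then d i / complex_of_real m else 0)" for i
    define e where "e = r * (\<rho> / 4) ^ s"
    have e: "e > 0" unfolding e_def using r \<rho> by simp
    have e_eq: "e = t / \<rho> ^ J / 2 ^ s"
    proof -
      have "(4::real) ^ s = 2 ^ s * 2 ^ s" by (simp flip: power_mult_distrib)
      then show ?thesis unfolding e_def r_def using \<rho> by (simp add: power_add power_divide)
    qed
    have comb: "(K ^^ p) (\<Sum>i\<le>N. c i *\<^sub>C y (k + p + i)) = (\<Sum>i\<le>N. c i *\<^sub>C y (k + i))" for p c k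
      by (rule funpow_combination) (rule shift)
    have "(K ^^ s) (x a) - (K ^^ s) (x b) = (\<Sum>i\<le>N. d i *\<^sub>C y (J + i))"
      unfolding x_def comb d_def by (simp add: sum_subtractf scale_left_diff_distrib)
    then obtain u where u: "u \<in> U" "(\<Sum>i\<le>N. d i *\<^sub>C y (J + i)) = complex_of_real e *\<^sub>C u"
      using ab(4) unfolding e_def by auto
    have "(\<Sum>i\<le>N. c i *\<^sub>C y (J + i)) = inverse (complex_of_real m) *\<^sub>C (\<Sum>i\<le>N. d i *\<^sub>C y (J + i))"
      unfolding scale_sum_right by (intro sum.cong) (auto simp: c_def divide_inverse mult.commute)
    also have "\<dots> = (inverse (complex_of_real m) * complex_of_real e) *\<^sub>C u"
      unfolding u by simp
    also have "\<dots> \<in> (*\<^sub>C) (complex_of_real e) ` U"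
    proof (rule balanced_scale_mem[OF balanced u(1)])
      show "cmod (inverse (complex_of_real m) * complex_of_real e) \<le> cmod (complex_of_real e)"
        unfolding norm_mult using m1 by (intro mult_left_le_one_le) (auto simp: norm_inverse inverse_le_1_iff)
    qed
    finally have cJ: "(\<Sum>i\<le>N. c i *\<^sub>C y (J + i)) \<in> (*\<^sub>C) (complex_of_real e) ` U" .
    have "(\<Sum>i\<le>N. c i *\<^sub>C y (j + i)) \<in> (*\<^sub>C) (complex_of_real ((1/2) ^ J)) ` C" if "j < J" for j
    proof -
      \<comment> \<open>The combination is small at position \<open>J\<close>. Applying
        \<open>K\<close> another \<open>p\<close> times brings it to \<open>Suc j\<close>, and one
        last application reaches \<open>j\<close> and replaces \<open>U\<close> by \<open>C\<close>.
        The factor \<open>t1 ^ J\<close> in \<open>B\<close> pays for this descent.\<close>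
      obtain p where p: "J = Suc j + p" using \<open>j < J\<close> by (metis less_iff_Suc_add add_Suc)
      have "(\<Sum>i\<le>N. c i *\<^sub>C y (Suc j + i)) \<in> (*\<^sub>C) (complex_of_real (e * t1 ^ p)) ` U"
        using funpow_image[OF _ t1(2) cJ, of p] t1(1) comb[of p c "Suc j"]
        unfolding p by simp
      also have "(*\<^sub>C) (complex_of_real (e * t1 ^ p)) ` U \<subseteq> (*\<^sub>C) (complex_of_real ((1/2) ^ J)) ` U"
      proof (rule scale_image_balanced_mono[OF balanced])
        have "t1 ^ p \<le> t1 ^ J" using t1(1) p by (intro power_increasing) auto
        then have "e * t1 ^ p \<le> e * t1 ^ J" using e by simp
        also have "\<dots> = B / 2 ^ s * (1/2) ^ J"
          unfolding e_eq B_def using \<rho> by (simp add: field_simps power_divide)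
        also have "\<dots> \<le> 1 * (1/2) ^ J"
          using s by (intro mult_right_mono) (auto simp: divide_le_eq)
        finally show "cmod (complex_of_real (e * t1 ^ p)) \<le> cmod (complex_of_real ((1/2) ^ J))"
          using e t1(1) unfolding norm_of_real by simp
      qed
      finally have "K (\<Sum>i\<le>N. c i *\<^sub>C y (Suc j + i)) \<in> (*\<^sub>C) (complex_of_real ((1/2) ^ J)) ` C"
        by (rule image_scaled)
      then show ?thesis by (simp add: K.sum K.scale shift)
    qed
    moreover have "\<exists>i\<le>N. cmod (c i) = 1"
      using i1 m1 by (intro exI[of _ i1]) (auto simp: c_def norm_divide)
    moreover have "cmod (c i) \<le> 1" for i
      using m_ge[of i] m1 by (auto simp: c_def norm_divide divide_le_eq_1)
    ultimately show "\<exists>c. (\<exists>i\<le>N. cmod (c i) = 1) \<and> (\<forall>i. cmod (c i) \<le> 1) \<and>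
      (\<forall>j<J. (\<Sum>i\<le>N. c i *\<^sub>C y (j + i)) \<in> (*\<^sub>C) (complex_of_real ((1/2) ^ J)) ` C)"
      by blast
  qed
qed

text \<open>For fixed \<open>j\<close> the combination depends continuously on the coefficients and
  is forced into every zero neighborhood as \<open>J\<close> grows. At a cluster point of the
  coefficient sequences it vanishes, by the Hausdorff property.\<close>

lemma exact_relation:
  assumes y: "backward_orbit \<rho> y" and \<rho>: "\<rho> > 0"
  obtains N c where "\<exists>i\<le>N. c i \<noteq> 0" "\<And>j. (\<Sum>i\<le>N::nat. c i *\<^sub>C y (j + i)) = 0"
proof -
  obtain N where "\<forall>J. \<exists>c. (\<exists>i\<le>N. cmod (c i) = 1) \<and> (\<forall>i. cmod (c i) \<le> 1) \<and>
    (\<forall>j<J. (\<Sum>i\<le>N. c i *\<^sub>C y (j + i)) \<in> (*\<^sub>C) (complex_of_real ((1/2) ^ J)) ` C)"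
    using approximate_relation[OF assms] by blast
  then obtain c where c: "\<And>J. \<exists>i\<le>N. cmod (c J i) = 1" "\<And>J i. cmod (c J i) \<le> 1"
    "\<And>J j. j < J \<Longrightarrow> (\<Sum>i\<le>N. c J i *\<^sub>C y (j + i)) \<in> (*\<^sub>C) (complex_of_real ((1/2) ^ J)) ` C"
    by metis
  have "compact {f :: nat \<Rightarrow> complex. \<forall>i. f i \<in> cball 0 1}"
    by (intro compact_PiE_UNIV) simp
  moreover have "c J \<in> {f. \<forall>i. f i \<in> cball 0 1}" for J using c(2) by simp
  ultimately obtain l :: "nat \<Rightarrow> complex" where
    l: "\<And>Q. closed Q \<Longrightarrow> \<forall>\<^sub>F J in sequentially. c J \<in> Q \<Longrightarrow> l \<in> Q"
    by (rule compact_cluster_point[where f = c]) (rule that)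
  have coord: "continuous_on UNIV (\<lambda>f :: nat \<Rightarrow> complex. f i)" for i
    by simp
  show thesis
  proof (rule that)
    \<comment> \<open>The index of the coefficient of modulus 1 may vary with \<open>J\<close>; a
      finite union is still closed, so some coefficient of the limit has modulus 1.\<close>
    have "closed (\<Union>i\<in>{..N}. (\<lambda>f :: nat \<Rightarrow> complex. cmod (f i)) -` {1})"
      by (intro closed_UN ballI closed_vimage continuous_on_norm coord) auto
    then have "l \<in> (\<Union>i\<in>{..N}. (\<lambda>f :: nat \<Rightarrow> complex. cmod (f i)) -` {1})"
      by (rule l) (use c(1) in \<open>auto intro!: always_eventually\<close>)
    then show "\<exists>i\<le>N. l i \<noteq> 0" by force
  next
    fix j
    define g where "g f = (\<Sum>i\<le>N. f i *\<^sub>C y (j + i))" for f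
    have g: "continuous_on UNIV g"
      unfolding g_def by (intro continuous_on_sum continuous_on_scale coord continuous_on_const)
    have "g l = 0"
    proof (rule ccontr)
      assume "g l \<noteq> 0"
      then obtain A B where AB: "open A" "open B" "0 \<in> A" "g l \<in> B" "A \<inter> B = {}"
        using hausdorff[of 0 "g l"] by metis
      then have "zero_nbhd A" by (intro zero_nbhdI) auto
      then obtain t where t: "t > 0" "\<And>c u. u \<in> C \<Longrightarrow> cmod c * t \<le> 1 \<Longrightarrow> c *\<^sub>C u \<in> A"
        by (rule C_absorbed) blast
      have "(\<lambda>J. (1/2) ^ J * t) \<longlonglongrightarrow> 0 * t"
        by (intro tendsto_intros LIMSEQ_power_zero) simp
      then have "\<forall>\<^sub>F J in sequentially. (1/2) ^ J * t < 1"
        by (intro order_tendstoD(2)[of _ "0 * t"]) auto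
      then have "\<forall>\<^sub>F J in sequentially. c J \<in> g -` (- B)"
        using eventually_gt_at_top[of j]
      proof eventually_elim
        case (elim J)
        obtain u where "u \<in> C" "g (c J) = complex_of_real ((1/2) ^ J) *\<^sub>C u"
          using c(3)[OF elim(2)] unfolding g_def by blast
        then have "g (c J) \<in> A" using t(2)[of u "complex_of_real ((1/2) ^ J)"] elim(1)
          by (simp add: norm_divide norm_power)
        then show ?case using AB by auto
      qed
      moreover have "closed (g -` (- B))"
        using AB by (intro closed_vimage g) auto
      ultimately have "l \<in> g -` (- B)" by (intro l)
      then show False using AB by simp
    qed
    then show "(\<Sum>i\<le>N. l i *\<^sub>C y (j + i)) = 0" unfolding g_def .
  qed
qed

section \<open>From a linear relation among the shifts to an eigenvector\<close>

definition annihilates :: "complex poly \<Rightarrow> (nat \<Rightarrow> 'a) \<Rightarrow> bool" where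
  "annihilates p y \<longleftrightarrow> (\<forall>j. (\<Sum>i\<le>degree p. coeff p i *\<^sub>C y (j + i)) = 0)"

text \<open>Let \<open>S\<close> be the shift that sends \<open>y\<close> to
  \<open>\<lambda>j. y (Suc j)\<close>; then \<open>annihilates p y\<close> says
  \<open>p(S) y = 0\<close>. If \<open>p\<close> has least degree and
  \<open>p = (X - \<mu>) q\<close>, then \<open>q(S) y\<close> is nonzero and is an eigenvector of
  \<open>S\<close> for \<open>\<mu>\<close>.\<close>

lemma geometric_backward_orbit:
  assumes y: "backward_orbit \<rho> y" "y 0 \<noteq> 0" and \<rho>: "\<rho> > 0"
  obtains w \<mu> where "backward_orbit \<rho> w" "w 0 \<noteq> 0" "\<And>k. w k = \<mu> ^ k *\<^sub>C w 0"
proof -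
  have shift: "\<And>k. K (y (Suc k)) = y k"
    using y unfolding backward_orbit_def by blast
  obtain N c where c: "\<exists>i\<le>N. c i \<noteq> 0" "\<And>j. (\<Sum>i\<le>N::nat. c i *\<^sub>C y (j + i)) = 0"
    using exact_relation[OF y(1) \<rho>] by blast
  define p0 where "p0 = (\<Sum>i\<le>N. monom (c i) i)"
  have coeff: "coeff p0 n = (if n \<le> N then c n else 0)" for n
    unfolding p0_def by (simp add: coeff_sum)
  have "p0 \<noteq> 0" using c(1) coeff by (metis coeff_0)
  moreover have "annihilates p0 y"
    unfolding annihilates_def
  proof
    fix j
    have "degree p0 \<le> N" by (rule degree_le) (simp add: coeff)
    then have "(\<Sum>i\<le>degree p0. coeff p0 i *\<^sub>C y (j + i)) = (\<Sum>i\<le>N. coeff p0 i *\<^sub>C y (j + i))"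
      by (intro sum.mono_neutral_left) (auto simp: coeff_eq_0)
    also have "\<dots> = 0" using c(2)[of j] by (simp add: coeff)
    finally show "(\<Sum>i\<le>degree p0. coeff p0 i *\<^sub>C y (j + i)) = 0" .
  qed
  ultimately obtain p where p: "p \<noteq> 0" "annihilates p y"
    and min: "\<And>q. q \<noteq> 0 \<Longrightarrow> annihilates q y \<Longrightarrow> degree p \<le> degree q"
    using ex_has_least_nat[of "\<lambda>p. p \<noteq> 0 \<and> annihilates p y" p0 degree] by blast
  have "degree p \<noteq> 0"
  proof
    assume "degree p = 0"
    then have "coeff p 0 *\<^sub>C y 0 = 0" "coeff p 0 \<noteq> 0"
      using p leading_coeff_0_iff[of p] unfolding annihilates_def by (auto dest: spec[of _ 0])
    then show False using y(2) by simp
  qed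
  then obtain \<mu> where "poly p \<mu> = 0"
    using fundamental_theorem_of_algebra[of p] by (auto simp: constant_degree)
  then obtain q where q: "p = [:- \<mu>, 1:] * q"
    by (metis poly_eq_0_iff_dvd dvdE)
  have "q \<noteq> 0" using p q by auto
  then have deg: "degree p = Suc (degree q)"
    unfolding q by (subst degree_mult_eq) auto
  \<comment> \<open>This is the sequence \<open>q(S) y\<close>.\<close>
  define w where "w j = (\<Sum>i\<le>degree q. coeff q i *\<^sub>C y (j + i))" for j
  have w_Suc: "w (Suc j) = \<mu> *\<^sub>C w j" for j
  proof -
    have p_eq: "p = pCons 0 q - smult \<mu> q" unfolding q by simp
    have "0 = (\<Sum>i\<le>Suc (degree q). coeff p i *\<^sub>C y (j + i))"
      using p(2) deg unfolding annihilates_def by simp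
    also have "\<dots> = (\<Sum>i\<le>Suc (degree q). coeff (pCons 0 q) i *\<^sub>C y (j + i))
        - \<mu> *\<^sub>C (\<Sum>i\<le>Suc (degree q). coeff q i *\<^sub>C y (j + i))"
      unfolding p_eq by (simp only: coeff_diff coeff_smult scale_left_diff_distrib sum_subtractf scale_sum_right scale_scale)
    also have "(\<Sum>i\<le>Suc (degree q). coeff q i *\<^sub>C y (j + i)) = w j"
      unfolding w_def by (simp add: coeff_eq_0)
    also have "(\<Sum>i\<le>Suc (degree q). coeff (pCons 0 q) i *\<^sub>C y (j + i)) = w (Suc j)"
      unfolding w_def sum.atMost_Suc_shift by simp
    finally show ?thesis by simp
  qed
  have w_pow: "w k = \<mu> ^ k *\<^sub>C w 0" for k
    by (induction k) (simp_all add: w_Suc)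
  \<comment> \<open>Minimality of the degree yields some nonzero \<open>w k\<close>; every
    \<open>w k\<close> is a multiple of \<open>w 0\<close>, so \<open>w 0\<close> itself is
    nonzero.\<close>
  have "\<not> annihilates q y"
    using min[OF \<open>q \<noteq> 0\<close>] deg by auto
  then have "\<exists>k. w k \<noteq> 0" unfolding annihilates_def w_def by blast
  then have w0: "w 0 \<noteq> 0" using w_pow by (metis scale_zero_right)
  have K_w: "K (w (Suc k)) = w k" for k
    unfolding w_def by (simp add: K.sum K.scale shift)
  define R where "R = 1 + Max ((\<lambda>i. cmod (coeff q i)) ` {..degree q})"
  have R_ge: "cmod (coeff q i) \<le> R" if "i \<le> degree q" for i
  proof -
    have "cmod (coeff q i) \<le> Max ((\<lambda>i. cmod (coeff q i)) ` {..degree q})"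
      using that by (intro Max_ge) auto
    then show ?thesis unfolding R_def by simp
  qed
  have "0 \<le> Max ((\<lambda>i. cmod (coeff q i)) ` {..degree q})"
    by (rule order_trans[OF norm_ge_zero Max_ge[OF _ imageI[of 0]]]) auto
  then have "R > 0" unfolding R_def by simp
  then obtain t where t: "t > 0" "\<And>c k. (\<And>i. i \<le> degree q \<Longrightarrow> cmod (c i) \<le> R) \<Longrightarrow>
       (\<Sum>i\<le>degree q. c i *\<^sub>C y (k + i)) \<in> (*\<^sub>C) (complex_of_real (t / \<rho> ^ k)) ` U"
    by (rule backward_orbit_combination_bound[OF y(1) \<rho>]) blast
  have "w k \<in> (*\<^sub>C) (complex_of_real (t / \<rho> / \<rho> ^ k)) ` C" for k
  proof -
    \<comment> \<open>The bound is taken one index further on, because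
      \<open>w k = K (w (Suc k))\<close> then lies in a multiple of \<open>C\<close>; this costs the
      factor \<open>1 / \<rho>\<close>.\<close>
    have "w (Suc k) \<in> (*\<^sub>C) (complex_of_real (t / \<rho> ^ Suc k)) ` U"
      unfolding w_def by (intro t(2) R_ge)
    from image_scaled[OF this] show ?thesis by (simp add: K_w)
  qed
  then have "backward_orbit \<rho> w"
    unfolding backward_orbit_def using K_w t(1) \<rho> by (intro conjI allI exI[of _ "t / \<rho>"]) auto
  from that[OF this w0 w_pow] show thesis .
qed

text \<open>\<open>K\<close> undoes multiplication by \<open>\<mu>\<close> on a geometric orbit, so
  the eigenvalue is the inverse of \<open>\<mu>\<close>. If \<open>cmod \<mu> * \<rho>\<close>
  exceeded 1, then \<open>w 0\<close>, being \<open>w k\<close> divided by \<open>\<mu> ^ k\<close>,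
  would lie in arbitrarily small multiples of \<open>C\<close> and hence vanish.\<close>

lemma eigenvalue_of_backward_orbit:
  assumes "backward_orbit \<rho> y" "y 0 \<noteq> 0" "\<rho> > 0"
  obtains l v where "v \<noteq> 0" "K v = l *\<^sub>C v" "\<rho> \<le> cmod l"
proof -
  obtain w \<mu> where w: "backward_orbit \<rho> w" "w 0 \<noteq> 0" and pow: "\<And>k. w k = \<mu> ^ k *\<^sub>C w 0"
    using geometric_backward_orbit[OF assms] by blast
  obtain t where t: "t > 0" "\<And>k. w k \<in> (*\<^sub>C) (complex_of_real (t / \<rho> ^ k)) ` C"
    using w(1) unfolding backward_orbit_def by blast
  have "K (w 1) = w 0" using w(1) unfolding backward_orbit_def by simp
  then have *: "\<mu> *\<^sub>C K (w 0) = w 0" using pow[of 1] by (simp add: K.scale)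
  then have \<mu>: "\<mu> \<noteq> 0" using w(2) by auto
  have "cmod \<mu> * \<rho> \<le> 1"
  proof (rule ccontr)
    assume "\<not> cmod \<mu> * \<rho> \<le> 1"
    then have gt: "cmod \<mu> * \<rho> > 1" by simp
    have "w 0 \<in> V" if V: "zero_nbhd V" for V
    proof -
      obtain t0 where t0: "t0 > 0" "\<And>c u. u \<in> C \<Longrightarrow> cmod c * t0 \<le> 1 \<Longrightarrow> c *\<^sub>C u \<in> V"
        using C_absorbed[OF V] by blast
      obtain k where k: "t * t0 < (cmod \<mu> * \<rho>) ^ k"
        using real_arch_pow[OF gt] by blast
      obtain u where u: "u \<in> C" "w k = complex_of_real (t / \<rho> ^ k) *\<^sub>C u"
        using t(2) by blast
      have "(inverse (\<mu> ^ k) * complex_of_real (t / \<rho> ^ k)) *\<^sub>C u \<in> V"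
      proof (rule t0(2)[OF u(1)])
        have "cmod (inverse (\<mu> ^ k) * complex_of_real (t / \<rho> ^ k)) * t0 = t * t0 / (cmod \<mu> * \<rho>) ^ k"
          using t(1) assms(3) by (simp add: norm_mult norm_inverse norm_divide norm_power power_mult_distrib field_simps)
        also have "\<dots> \<le> 1" using k gt by (simp add: divide_le_eq_1)
        finally show "cmod (inverse (\<mu> ^ k) * complex_of_real (t / \<rho> ^ k)) * t0 \<le> 1" .
      qed
      also have "(inverse (\<mu> ^ k) * complex_of_real (t / \<rho> ^ k)) *\<^sub>C u = inverse (\<mu> ^ k) *\<^sub>C w k"
        unfolding u(2) by simp
      also have "\<dots> = w 0" using pow[of k] \<mu> by simp
      finally show ?thesis .
    qed
    then show False using eq_zero_if_in_all_nbhds w(2) by blast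
  qed
  then have "\<rho> \<le> cmod (inverse \<mu>)" using \<mu> unfolding norm_inverse by (simp add: inverse_eq_divide le_divide_eq mult.commute)
  moreover have "K (w 0) = inverse \<mu> *\<^sub>C w 0"
    using arg_cong[OF *, of "(*\<^sub>C) (inverse \<mu>)"] \<mu> by simp
  ultimately show thesis using that w(2) by blast
qed

section \<open>Growth of the powers and construction of backward orbits\<close>

lemma powers_vanish_of_growth_bound:
  assumes "M > 0" "0 < \<rho>" "\<rho> < \<nu>"
    and bound: "\<And>n x. x \<in> U \<Longrightarrow> (K ^^ n) x \<in> (*\<^sub>C) (complex_of_real (M * \<rho> ^ n)) ` U"
  shows "powers_vanish NB K \<nu>"
  unfolding powers_vanish.simps
proof (intro exI[of _ U] conjI allI impI nbhd)
  fix V assume "zero_nbhd V"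
  then obtain t where t: "t > 0" "\<And>c u. u \<in> C \<Longrightarrow> cmod c * t \<le> 1 \<Longrightarrow> c *\<^sub>C u \<in> V"
    by (rule C_absorbed) blast
  \<comment> \<open>One of the \<open>n\<close> applications of \<open>K\<close> is spent on passing
    from \<open>U\<close> to \<open>C\<close>, so the growth bound is used with exponent
    \<open>n - 1\<close>; this gives the divisor \<open>\<rho>\<close>.\<close>
  have "(\<lambda>n. M * t / \<rho> * (\<rho> / \<nu>) ^ n) \<longlonglongrightarrow> M * t / \<rho> * 0"
    using assms by (intro tendsto_intros LIMSEQ_power_zero) simp
  then have "\<forall>\<^sub>F n in sequentially. M * t / \<rho> * (\<rho> / \<nu>) ^ n < 1"
    by (intro order_tendstoD(2)[of _ "M * t / \<rho> * 0"]) auto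
  then show "\<forall>\<^sub>F n in sequentially. scaled_iterate K \<nu> n ` U \<subseteq> V"
    using eventually_gt_at_top[of 0]
  proof eventually_elim
    case (elim n)
    then obtain m where m: "n = Suc m" by (cases n) auto
    show ?case
    proof
      fix z assume "z \<in> scaled_iterate K \<nu> n ` U"
      then obtain x where x: "x \<in> U" "z = complex_of_real (1 / \<nu> ^ n) *\<^sub>C K ((K ^^ m) x)"
        unfolding scaled_iterate_def m by auto
      then obtain u where u: "u \<in> C" "K ((K ^^ m) x) = complex_of_real (M * \<rho> ^ m) *\<^sub>C u"
        using image_scaled[OF bound[OF x(1), of m]] by blast
      have "(complex_of_real (1 / \<nu> ^ n) * complex_of_real (M * \<rho> ^ m)) *\<^sub>C u \<in> V"
      proof (rule t(2)[OF u(1)])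
        have "cmod (complex_of_real (1 / \<nu> ^ n) * complex_of_real (M * \<rho> ^ m)) * t = M * t / \<rho> * (\<rho> / \<nu>) ^ n"
          using assms by (simp add: m norm_mult norm_divide norm_power power_divide field_simps)
        then show "cmod (complex_of_real (1 / \<nu> ^ n) * complex_of_real (M * \<rho> ^ m)) * t \<le> 1"
          using elim(1) by simp
      qed
      then show "z \<in> V" unfolding x(2) u(2) by simp
    qed
  qed
qed

text \<open>At the first exponent \<open>n\<close> where the bound with constant \<open>M\<close>
  fails, all smaller powers still obey it. Reading the iterates of the offending \<open>x\<close>
  backwards from \<open>n\<close> gives an orbit whose size is controlled relative to its
  start.\<close>

lemma finite_backward_orbit:
  assumes "0 < \<rho>"
    and unbounded: "\<And>M. M > 0 \<Longrightarrow> \<exists>n. \<exists>x\<in>U. (K ^^ n) x \<notin> (*\<^sub>C) (complex_of_real (M * \<rho> ^ n)) ` U"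
  shows "\<exists>z. z 0 \<notin> U \<and> (\<forall>k<J. K (z (Suc k)) = z k) \<and>
    (\<forall>k. z k \<in> (*\<^sub>C) (complex_of_real (1 / \<rho> ^ Suc k)) ` C)"
proof -
  obtain t where t: "t > 0" "C \<subseteq> (*\<^sub>C) (complex_of_real t) ` U"
    using compact_absorbed[OF compact nbhd balanced] .
  \<comment> \<open>The trivial estimate puts \<open>K ^^ n\<close> of \<open>U\<close> into
    \<open>t ^ n\<close> times \<open>U\<close>. This \<open>M\<close> dominates
    \<open>(t / \<rho>) ^ n\<close> for all \<open>n \<le> J\<close>, so the first failure comes
    after \<open>J\<close>.\<close>
  define M where "M = (1 + t / \<rho>) ^ J"
  have base: "1 + t / \<rho> > 1" using t assms(1) by simp
  have M: "M > 0" unfolding M_def using base by (intro zero_less_power) linarith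
  define P where "P n \<longleftrightarrow> (\<exists>x\<in>U. (K ^^ n) x \<notin> (*\<^sub>C) (complex_of_real (M * \<rho> ^ n)) ` U)" for n
  define n where "n = (LEAST n. P n)"
  have "\<exists>n. P n" using unbounded[OF M] unfolding P_def .
  then have "P n" unfolding n_def by (rule LeastI_ex)
  then obtain x where x: "x \<in> U" "(K ^^ n) x \<notin> (*\<^sub>C) (complex_of_real (M * \<rho> ^ n)) ` U"
    unfolding P_def by blast
  have less: "(K ^^ m) x \<in> (*\<^sub>C) (complex_of_real (M * \<rho> ^ m)) ` U" if "m < n" for m
    using not_less_Least[of m P] that x(1) unfolding n_def P_def by blast
  have "J < n"
  proof (rule ccontr)
    assume "\<not> J < n"
    have "(t / \<rho>) ^ n \<le> (1 + t / \<rho>) ^ n"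
      using t assms(1) by (intro power_mono) auto
    also have "\<dots> \<le> M" unfolding M_def
      using base \<open>\<not> J < n\<close> by (intro power_increasing) auto
    finally have "t ^ n \<le> M * \<rho> ^ n"
      using assms(1) by (simp add: power_divide divide_le_eq)
    then have "(*\<^sub>C) (complex_of_real (1 * t ^ n)) ` U \<subseteq> (*\<^sub>C) (complex_of_real (M * \<rho> ^ n)) ` U"
      using t(1) M assms(1)
      by (intro scale_image_balanced_mono[OF balanced]) (simp only: norm_of_real, simp)
    moreover have "(K ^^ n) x \<in> (*\<^sub>C) (complex_of_real (1 * t ^ n)) ` U"
      by (rule funpow_image[OF t]) (use x(1) in simp)
    ultimately show False using x(2) by blast
  qed
  define q where "q = complex_of_real (M * \<rho> ^ n)"
  have q: "q \<noteq> 0" unfolding q_def using M assms(1) by simp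
  \<comment> \<open>Dividing by \<open>M * \<rho> ^ n\<close> puts \<open>z 0\<close> outside
    \<open>U\<close>. The value 0 for \<open>k \<ge> n\<close> keeps the whole sequence in the
    product of multiples of \<open>C\<close>, since \<open>C\<close> contains
    \<open>K 0 = 0\<close>; the recursion is claimed only for \<open>k < J\<close>, and
    \<open>J < n\<close>.\<close>
  define z where "z k = (if k < n then inverse q *\<^sub>C (K ^^ (n - k)) x else 0)" for k
  have "z 0 \<notin> U"
    using x(2) \<open>J < n\<close> unfolding q_def[symmetric] mem_scale_image_iff[OF q] by (simp add: z_def)
  moreover have "K (z (Suc k)) = z k" if "k < J" for k
  proof -
    have "Suc k < n" "n - k = Suc (n - Suc k)" using that \<open>J < n\<close> by auto
    then show ?thesis by (simp add: z_def K.scale)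
  qed
  moreover have "z k \<in> (*\<^sub>C) (complex_of_real (1 / \<rho> ^ Suc k)) ` C" for k
  proof (cases "k < n")
    case True
    then have eq: "n = Suc k + (n - Suc k)" "n - k = Suc (n - Suc k)" by auto
    define m where "m = n - Suc k"
    have "(K ^^ Suc m) x \<in> (*\<^sub>C) (complex_of_real (M * \<rho> ^ m)) ` C"
      using image_scaled[OF less[of m]] True unfolding m_def by simp
    then obtain u where u: "u \<in> C" "(K ^^ Suc m) x = complex_of_real (M * \<rho> ^ m) *\<^sub>C u" by blast
    have "z k = inverse q *\<^sub>C (K ^^ Suc m) x"
      using True eq(2) unfolding z_def m_def by (simp del: funpow.simps)
    also have "\<dots> = complex_of_real (inverse (M * \<rho> ^ n) * (M * \<rho> ^ m)) *\<^sub>C u"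
      unfolding u(2) q_def by simp
    also have "inverse (M * \<rho> ^ n) * (M * \<rho> ^ m) = 1 / \<rho> ^ Suc k"
      using M assms(1) eq(1) unfolding m_def[symmetric]
      by (simp add: power_add field_simps)
    finally show ?thesis using u(1) by blast
  next
    case False
    have "0 \<in> C" using image imageI[OF zero_in_nbhd[OF nbhd], of K] by auto
    then show ?thesis using False by (auto simp: z_def image_iff intro!: bexI[of _ 0])
  qed
  ultimately show ?thesis by blast
qed

lemma infinite_backward_orbit:
  assumes "0 < \<rho>"
    and "\<And>M. M > 0 \<Longrightarrow> \<exists>n. \<exists>x\<in>U. (K ^^ n) x \<notin> (*\<^sub>C) (complex_of_real (M * \<rho> ^ n)) ` U"
  obtains y where "backward_orbit \<rho> y" "y 0 \<noteq> 0"
proof -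
  let ?S = "{f. \<forall>k. f k \<in> (*\<^sub>C) (complex_of_real (1 / \<rho> ^ Suc k)) ` C}"
  obtain z where z: "\<And>J. z J 0 \<notin> U" "\<And>J k. k < J \<Longrightarrow> K (z J (Suc k)) = z J k"
    "\<And>J. z J \<in> ?S"
    using finite_backward_orbit[OF assms] by simp metis
  have "compact ?S"
    by (intro compact_PiE_UNIV compact_continuous_image[OF _ compact] continuous_on_scale continuous_intros)
  then obtain y where y: "y \<in> ?S"
    and lim: "\<And>Q. closed Q \<Longrightarrow> \<forall>\<^sub>F J in sequentially. z J \<in> Q \<Longrightarrow> y \<in> Q"
    using z(3) by (rule compact_cluster_point[where f = z]) (rule that)
  have coord: "continuous_on UNIV (\<lambda>f :: nat \<Rightarrow> 'a. f i)" for i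
    by simp
  \<comment> \<open>Nonvanishing is not a closed condition, but avoiding the interior of
    \<open>U\<close> is; it survives the limit and excludes 0.\<close>
  have "y \<in> (\<lambda>f. f 0) -` (- interior U)"
    using z(1) interior_subset[of U]
    by (intro lim closed_vimage coord) (auto intro!: always_eventually)
  then have "y 0 \<noteq> 0" using nbhd by (auto simp: zero_nbhd_def)
  moreover have "K (y (Suc k)) = y k" for k
  proof -
    have "closed {f :: nat \<Rightarrow> 'a. K (f (Suc k)) = f k}"
      by (intro closed_Collect_eq continuous_on_compose2[OF continuous] coord) simp
    moreover have "\<forall>\<^sub>F J in sequentially. z J \<in> {f. K (f (Suc k)) = f k}"
      using eventually_gt_at_top[of k] by eventually_elim (simp add: z(2))
    ultimately show ?thesis using lim by blast
  qed
  ultimately show thesis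
    using y assms(1) unfolding backward_orbit_def
    by (intro that[of y]) (auto simp: backward_orbit_def intro!: exI[of _ "1 / \<rho>"])
qed

lemma powers_vanish_or_eigenvalue:
  assumes "0 < \<rho>" "\<rho> < \<nu>"
  shows "powers_vanish NB K \<nu> \<or> (\<exists>l v. v \<noteq> 0 \<and> K v = l *\<^sub>C v \<and> \<rho> \<le> cmod l)"
proof (cases "\<exists>M>0. \<forall>n. \<forall>x\<in>U. (K ^^ n) x \<in> (*\<^sub>C) (complex_of_real (M * \<rho> ^ n)) ` U")
  case True
  then obtain M where M: "M > 0" and
    bound: "\<forall>n. \<forall>x\<in>U. (K ^^ n) x \<in> (*\<^sub>C) (complex_of_real (M * \<rho> ^ n)) ` U"
    by (elim exE conjE)
  have "powers_vanish NB K \<nu>"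
    by (rule powers_vanish_of_growth_bound[OF M assms]) (rule bound[rule_format])
  then show ?thesis ..
next
  case False
  have "\<exists>n. \<exists>x\<in>U. (K ^^ n) x \<notin> (*\<^sub>C) (complex_of_real (M * \<rho> ^ n)) ` U" if "M > 0" for M
    using False that by (simp only: not_ex not_all ball_simps de_Morgan_conj) metis
  then obtain y where y: "backward_orbit \<rho> y" "y 0 \<noteq> 0"
    by (rule infinite_backward_orbit[OF assms(1)])
  obtain l v where "v \<noteq> 0" "K v = l *\<^sub>C v" "\<rho> \<le> cmod l"
    using eigenvalue_of_backward_orbit[OF y assms(1)] .
  then show ?thesis by blast
qed

end

subsection \<open>Spectra and spectral radii of the four flavours\<close>

context complex_tvs
begin

text \<open>An eigenvector already rules out every left inverse, whatever boundedness is required of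
  it, so the flavour \<open>k\<close> is arbitrary.\<close>

lemma eigenvalue_in_spectrum:
  assumes "linear_op T" "v \<noteq> 0" "T v = l *\<^sub>C v"
  shows "l \<in> spectrum k T"
proof -
  have False if "R \<circ> (\<lambda>x. l *\<^sub>C x - T x) = id" for R
  proof -
    have "R (l *\<^sub>C x - T x) = x" for x using fun_cong[OF that, of x] by simp
    moreover have "T 0 = 0"
      using Vector_Spaces.linear.axioms(3)[OF assms(1)] by (rule module_hom.zero)
    ultimately show False using assms(2,3) by (metis diff_self scale_zero_right)
  qed
  then show ?thesis unfolding spectrum_def resolvent_set_def by blast
qed

lemma scaled_iterate_scale:
  assumes "linear_op T"
  shows "scaled_iterate T \<nu> n (c *\<^sub>C x) = c *\<^sub>C scaled_iterate T \<nu> n x"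
proof -
  interpret T: module_hom scale scale T
    using assms by (rule Vector_Spaces.linear.axioms(3))
  have "(T ^^ n) (c *\<^sub>C x) = c *\<^sub>C (T ^^ n) x"
    by (induction n) (simp_all add: T.scale)
  then show ?thesis unfolding scaled_iterate_def by (simp add: mult.commute)
qed

lemma base_nbhd_subset:
  assumes "zero_nbhd V"
  obtains W where "zero_nbhd W" "balanced W" "locally_convex \<longrightarrow> cvx W" "W \<subseteq> V"
proof (cases locally_convex)
  case False
  then show ?thesis using balanced_nbhd_subset[OF assms] that by blast
next
  case True
  then obtain U where U: "U \<subseteq> V" "zero_nbhd U" "cvx U"
    using assms unfolding locally_convex_def by blast
  obtain W0 where W0: "zero_nbhd W0" "balanced W0" "W0 \<subseteq> U"
    using balanced_nbhd_subset[OF U(2)] .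
  \<comment> \<open>The balanced core of \<open>U\<close> inherits convexity, and it is a
    neighborhood because it contains the balanced \<open>W0\<close>. The set \<open>W0\<close> alone
    might fail to be convex.\<close>
  define W where "W = {x. \<forall>c. cmod c \<le> 1 \<longrightarrow> c *\<^sub>C x \<in> U}"
  have "W0 \<subseteq> W" unfolding W_def using W0 balanced_mem by blast
  then have "zero_nbhd W" using W0(1) zero_nbhd_mono by blast
  moreover have "balanced W"
    unfolding balanced_def W_def by (auto simp: norm_mult mult_le_one)
  moreover have "cvx W"
    unfolding cvx_def
  proof (intro ballI allI impI)
    fix x y and u v :: real
    assume xy: "x \<in> W" "y \<in> W" and uv: "0 \<le> u" "0 \<le> v" "u + v = 1"
    show "complex_of_real u *\<^sub>C x + complex_of_real v *\<^sub>C y \<in> W"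
      unfolding W_def
    proof (intro CollectI allI impI)
      fix c assume c: "cmod c \<le> 1"
      have "complex_of_real u *\<^sub>C (c *\<^sub>C x) + complex_of_real v *\<^sub>C (c *\<^sub>C y) \<in> U"
        using xy c uv U(3) unfolding W_def cvx_def by blast
      then show "c *\<^sub>C (complex_of_real u *\<^sub>C x + complex_of_real v *\<^sub>C y) \<in> U"
        by (simp add: scale_right_distrib mult.commute)
    qed
  qed
  moreover have "W \<subseteq> U"
    unfolding W_def by (auto dest: spec[of _ 1])
  ultimately show ?thesis using that U(1) by blast
qed

text \<open>This is the base for the nn flavour: each member lies in a multiple of \<open>U\<close>,
  so convergence that is uniform on \<open>U\<close> is uniform on each member. Allowing all nonzero
  multiples makes the family closed under scaling.\<close>

lemma zero_base_absorbed_by: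
  assumes "zero_nbhd U"
  shows "zero_base {V. zero_nbhd V \<and> balanced V \<and> (locally_convex \<longrightarrow> cvx V) \<and>
    (\<exists>c. c \<noteq> 0 \<and> V \<subseteq> (*\<^sub>C) c ` U)}" (is "zero_base ?N")
proof -
  have refine: "\<exists>W\<in>?N. W \<subseteq> V" if V: "zero_nbhd V" for V
  proof -
    obtain W where "zero_nbhd W" "balanced W" "locally_convex \<longrightarrow> cvx W" "W \<subseteq> V \<inter> U"
      using base_nbhd_subset[OF zero_nbhd_Int[OF V assms]] .
    moreover from this have "\<exists>c. c \<noteq> 0 \<and> W \<subseteq> (*\<^sub>C) c ` U" by (intro exI[of _ 1]) simp
    ultimately show ?thesis by (intro bexI[of _ W]) auto
  qed
  have scaled: "(*\<^sub>C) c ` V \<in> ?N" if V: "V \<in> ?N" and c: "c \<noteq> 0" for c V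
  proof -
    obtain d where d: "d \<noteq> 0" "V \<subseteq> (*\<^sub>C) d ` U" using V by blast
    have "zero_nbhd ((*\<^sub>C) c ` V)"
      using V c by (intro zero_nbhd_scale_image) auto
    moreover have "balanced ((*\<^sub>C) c ` V)"
      unfolding balanced_def
    proof safe
      fix e v assume "cmod e \<le> 1" "v \<in> V"
      then have "e *\<^sub>C v \<in> V" using V balanced_mem by blast
      then have "c *\<^sub>C e *\<^sub>C v \<in> (*\<^sub>C) c ` V" by blast
      then show "e *\<^sub>C c *\<^sub>C v \<in> (*\<^sub>C) c ` V" by (simp add: mult.commute)
    qed
    moreover have "cvx ((*\<^sub>C) c ` V)" if "locally_convex"
      unfolding cvx_def
    proof safe
      fix x y and u v :: real
      assume "x \<in> V" "y \<in> V" "0 \<le> u" "0 \<le> v" "u + v = 1"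
      then have "complex_of_real u *\<^sub>C x + complex_of_real v *\<^sub>C y \<in> V"
        using V that unfolding cvx_def by blast
      then have "c *\<^sub>C (complex_of_real u *\<^sub>C x + complex_of_real v *\<^sub>C y) \<in> (*\<^sub>C) c ` V" by blast
      then show "complex_of_real u *\<^sub>C c *\<^sub>C x + complex_of_real v *\<^sub>C c *\<^sub>C y \<in> (*\<^sub>C) c ` V"
        by (simp add: scale_right_distrib mult.commute)
    qed
    moreover have "(*\<^sub>C) c ` V \<subseteq> (*\<^sub>C) (c * d) ` U"
      using d(2) by force
    ultimately show ?thesis using c d(1) by (auto intro!: exI[of _ "c * d"])
  qed
  have half: "\<exists>W\<in>?N. \<forall>x\<in>W. \<forall>y\<in>W. x + y \<in> V" if "V \<in> ?N" for V
  proof -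
    have "zero_nbhd V" using that by simp
    then obtain W0 where W0: "zero_nbhd W0" "\<And>x y. x \<in> W0 \<Longrightarrow> y \<in> W0 \<Longrightarrow> x + y \<in> V"
      by (rule half_nbhd) blast
    obtain W where W: "W \<in> ?N" "W \<subseteq> W0"
      using refine[OF W0(1)] by (rule bexE)
    show ?thesis
      by (rule bexI[OF _ W(1)]) (intro ballI W0(2) subsetD[OF W(2)])
  qed
  have inter: "\<exists>W\<in>?N. W \<subseteq> V\<^sub>1 \<inter> V\<^sub>2" if "V\<^sub>1 \<in> ?N" "V\<^sub>2 \<in> ?N" for V\<^sub>1 V\<^sub>2
    using that by (intro refine zero_nbhd_Int) auto
  show ?thesis
    unfolding zero_base_def
  proof (intro conjI allI ballI impI)
    fix V\<^sub>1 V\<^sub>2 assume "V\<^sub>1 \<in> ?N" "V\<^sub>2 \<in> ?N"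
    then show "\<exists>W\<in>?N. W \<subseteq> V\<^sub>1 \<inter> V\<^sub>2" by (rule inter)
  qed (simp, erule refine, simp, erule (1) scaled, erule half, simp)
qed

text \<open>Convergence that is uniform on \<open>U\<close> is uniform on every subset of a multiple
  of \<open>U\<close>, by rescaling the target. In each flavour the sets to be tested can be taken
  of this kind: bounded sets, \<open>U\<close> itself, or members of a suitable base.\<close>

lemma powers_vanish_of_NB:
  assumes T: "linear_op T" and "powers_vanish NB T \<nu>"
  shows "powers_vanish k T \<nu>"
proof -
  obtain U where U: "zero_nbhd U"
    "\<And>V. zero_nbhd V \<Longrightarrow> \<forall>\<^sub>F n in sequentially. scaled_iterate T \<nu> n ` U \<subseteq> V"
    using assms(2) by auto
  have scaled: "\<forall>\<^sub>F n in sequentially. scaled_iterate T \<nu> n ` B \<subseteq> V"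
    if V: "zero_nbhd V" and B: "B \<subseteq> (*\<^sub>C) c ` U" and c: "c \<noteq> 0" for V B c
  proof -
    have "zero_nbhd ((*\<^sub>C) (inverse c) ` V)"
      using V c by (intro zero_nbhd_scale_image) auto
    from U(2)[OF this] show ?thesis
    proof eventually_elim
      case (elim n)
      show ?case
      proof
        fix z assume "z \<in> scaled_iterate T \<nu> n ` B"
        then obtain u where "u \<in> U" "z = scaled_iterate T \<nu> n (c *\<^sub>C u)" using B by blast
        moreover from this elim obtain v where "v \<in> V" "scaled_iterate T \<nu> n u = inverse c *\<^sub>C v" by blast
        ultimately show "z \<in> V" using c by (simp add: scaled_iterate_scale[OF T])
      qed
    qed
  qed
  show ?thesis
  proof (cases k)
    case BB
    have "\<forall>\<^sub>F n in sequentially. scaled_iterate T \<nu> n ` B \<subseteq> V"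
      if B: "bounded_set B" and V: "zero_nbhd V" for B V
    proof -
      obtain r where "r > 0" "\<forall>c. r \<le> cmod c \<longrightarrow> B \<subseteq> (*\<^sub>C) c ` U"
        using B U(1) unfolding bounded_set_def by blast
      then have "B \<subseteq> (*\<^sub>C) (complex_of_real r) ` U" "complex_of_real r \<noteq> 0" by auto
      then show ?thesis using scaled[OF V] by blast
    qed
    then show ?thesis using BB by simp
  next
    case Cont
    have "\<forall>\<^sub>F n in sequentially. scaled_iterate T \<nu> n ` U \<subseteq> (*\<^sub>C) (complex_of_real \<epsilon>) ` V"
      if "zero_nbhd V" "\<epsilon> > 0" for V \<epsilon>
      by (intro U(2) zero_nbhd_scale_image) (use that in auto)
    then show ?thesis using Cont U(1) by (auto intro!: exI[of _ U])
  next
    case NN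
    show ?thesis
      unfolding NN powers_vanish.simps
    proof (intro exI[of _ "{V. zero_nbhd V \<and> balanced V \<and> (locally_convex \<longrightarrow> cvx V) \<and>
        (\<exists>c. c \<noteq> 0 \<and> V \<subseteq> (*\<^sub>C) c ` U)}"] conjI zero_base_absorbed_by[OF U(1)] ballI allI impI)
      fix V and \<epsilon> :: real
      assume V: "V \<in> {V. zero_nbhd V \<and> balanced V \<and> (locally_convex \<longrightarrow> cvx V) \<and>
        (\<exists>c. c \<noteq> 0 \<and> V \<subseteq> (*\<^sub>C) c ` U)}" and "\<epsilon> > 0"
      then obtain c where "c \<noteq> 0" "V \<subseteq> (*\<^sub>C) c ` U" by blast
      moreover have "zero_nbhd ((*\<^sub>C) (complex_of_real \<epsilon>) ` V)"
        using V \<open>\<epsilon> > 0\<close> by (intro zero_nbhd_scale_image) auto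
      ultimately show "\<forall>\<^sub>F n in sequentially. scaled_iterate T \<nu> n ` V \<subseteq> (*\<^sub>C) (complex_of_real \<epsilon>) ` V"
        by (intro scaled)
    qed
  next
    case NB
    then show ?thesis using assms(2) by simp
  qed
qed

end

theorem theorem7p2:
  fixes scale :: "complex \<Rightarrow> 'a::{topological_ab_group_add, t2_space} \<Rightarrow> 'a"
    and K :: "'a \<Rightarrow> 'a"
  assumes "complex_tvs scale"
    and "complex_tvs.compact_op scale K"
  shows "\<forall>i j. complex_tvs.spectral_radius scale i K \<le> complex_tvs.geometric_radius scale j K"
proof (intro allI)
  fix i j
  interpret complex_tvs scale by (fact assms(1))
  obtain U\<^sub>0 where K: "linear_op K" and U\<^sub>0: "zero_nbhd U\<^sub>0" "compact (closure (K ` U\<^sub>0))"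
    using assms(2) unfolding compact_op_def by blast
  obtain U where U: "zero_nbhd U" "balanced U" "U \<subseteq> U\<^sub>0"
    using balanced_nbhd_subset[OF U\<^sub>0(1)] .
  interpret compact_operator scale K U "closure (K ` U\<^sub>0)"
    using U closure_subset[of "K ` U\<^sub>0"] by (intro compact_operator.intro compact_operator_axioms.intro complex_tvs_axioms) (use K U\<^sub>0 in auto)
  show "spectral_radius i K \<le> geometric_radius j K"
  proof (rule ccontr)
    assume "\<not> spectral_radius i K \<le> geometric_radius j K"
    then have "geometric_radius j K < spectral_radius i K" by simp
    \<comment> \<open>Two intermediate values are taken because a growth bound at rate
      \<open>\<rho>\<close> yields vanishing only for \<open>\<nu>\<close> strictly above
      \<open>\<rho>\<close>. Lying strictly between extended values makes both positive and
      finite.\<close>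
    from dense[OF this] obtain \<nu>' where \<nu>': "geometric_radius j K < \<nu>'" "\<nu>' < spectral_radius i K"
      by blast
    from dense[OF \<nu>'(1)] obtain \<rho>' where \<rho>': "geometric_radius j K < \<rho>'" "\<rho>' < \<nu>'"
      by blast
    define \<nu> \<rho> where "\<nu> = enn2real \<nu>'" and "\<rho> = enn2real \<rho>'"
    have "0 < \<nu>'" "0 < \<rho>'" "\<nu>' < top" "\<rho>' < top"
      using le_less_trans[OF zero_le \<nu>'(1)] le_less_trans[OF zero_le \<rho>'(1)]
        less_le_trans[OF \<nu>'(2) top_greatest] less_trans[OF \<rho>'(2) less_le_trans[OF \<nu>'(2) top_greatest]]
      by simp_all
    then have \<nu>: "\<nu>' = ennreal \<nu>" "0 < \<nu>" and \<rho>: "\<rho>' = ennreal \<rho>" "0 < \<rho>"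
      unfolding \<nu>_def \<rho>_def by (simp_all add: enn2real_positive_iff)
    have "\<rho> < \<nu>" using \<rho>'(2) \<rho> \<nu> by (simp add: ennreal_less_iff)
    have "\<not> powers_vanish NB K \<nu>"
    proof
      assume "powers_vanish NB K \<nu>"
      then have "spectral_radius i K \<le> ennreal \<nu>"
        unfolding spectral_radius_def using powers_vanish_of_NB[OF K] \<nu>(2) by (intro INF_lower) blast
      then show False using \<nu>'(2) \<nu>(1) by simp
    qed
    then obtain l v where v: "v \<noteq> 0" "K v = scale l v" "\<rho> \<le> cmod l"
      using powers_vanish_or_eigenvalue[OF \<rho>(2) \<open>\<rho> < \<nu>\<close>] by blast
    have "ennreal \<rho> \<le> ennreal (cmod l)" using v(3) by (rule ennreal_leI)
    also have "\<dots> \<le> geometric_radius j K"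
      unfolding geometric_radius_def using eigenvalue_in_spectrum[OF K v(1,2)] by (intro SUP_upper)
    finally show False using \<rho>'(1) \<rho>(1) by simp
  qed
qed

end
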